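(* Let $Q>1$ and let $(X,d,\mu)$ be a space of $Q$-bounded geometry. Then $(X,d,\mu)$ is $A_{\infty}$ on curves.
   Context: A continuum is a compact connected (subset of a) metric space; a rectifiable continuum is a continuum of finite $\mathcal{H}^1$-measure. $\mathcal{H}^1$ is one-dimensional Hausdorff measure and $\mathcal{H}^1_\infty$ is one-dimensional Hausdorff content, $\mathcal{H}^1_\infty(E)=\inf\{\sum_i \operatorname{diam}(E_i): E\subset\bigcup_i E_i\}$ over countable covers. A Borel function $g:X\to[0,\infty]$ is an upper gradient of $u$ if $|u(x)-u(y)|\leq\int_\gamma g\,d\mathcal{H}^1$ for all rectifiable continua $\gamma\subset X$ joining $x$ to $y$. For $Q>1$, $(X,d,\mu)$ is a space of $Q$-bounded geometry if: $(X,d)$ is proper and path connected; $\mu$ is Borel and $Q$-regular, i.e. $\mu(B(x,r))\sim r^Q$ for all $x\in X$, $0<r\leq\operatorname{diam}(X)$ (two-sided comparability with constants independent of $x,r$); and $X$ supports a weak $(1,Q)$-Poincaré inequality: there exist constants $C,\lambda\geq1$ such that whenever $x\in X$, $r>0$, $u\in L^1_{\mathrm{loc}}(\mu)$ and $g\geq0$ is an upper gradient of $u$, then $$\frac{1}{\mu(B(x,r))}\int_{B(x,r)}|u-u_{B(x,r)}|\,d\mu\leq Cr\left(\frac{1}{\mu(B(x,\lambda r))}\int_{B(x,\lambda r)}g^Q\,d\mu\right)^{1/Q},$$ where $u_{B}$ denotes the $\mu$-average of $u$ over $B$. $(X,d,\mu)$ is $A_\infty$ on curves if there are constants $\tau<1$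 and $\theta>0$ such that whenever $x\in X$, $0<r\leq\operatorname{diam}(X)$, and $S\subset B(x,r)$ is a Borel set with $\mu(S)>\tau\mu(B(x,r))$, there exists a continuum $\gamma\subset B(x,r)$ with $\mathcal{H}^1(\gamma)\leq r$ and $\mathcal{H}^1_\infty(\gamma\cap S)\geq\theta r$. *)

theory Defs
  imports "HOL-Analysis.Analysis"
begin

section \<open>One-dimensional Hausdorff content and measure\<close>

(* The library's "diameter" is real-valued and carries no information on unbounded sets,
   hence an extended-valued variant.  The diameter of the empty set is 0. *)
definition ediam :: "'a::metric_space set \<Rightarrow> ennreal" where
  "ediam E = (SUP x\<in>E. SUP y\<in>E. ennreal (dist x y))"

(* Covers are sequences of sets; finite covers are padded with empty sets. *)
definition hausdorff1_content :: "'a::metric_space set \<Rightarrow> ennreal" where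
  "hausdorff1_content E = (INF A\<in>{A :: nat \<Rightarrow> 'a set. E \<subseteq> (\<Union>i. A i)}. \<Sum>i. ediam (A i))"

definition hausdorff1_pre :: "real \<Rightarrow> 'a::metric_space set \<Rightarrow> ennreal" where
  "hausdorff1_pre \<delta> E =
     (INF A\<in>{A :: nat \<Rightarrow> 'a set. E \<subseteq> (\<Union>i. A i) \<and> (\<forall>i. ediam (A i) \<le> ennreal \<delta>)}. \<Sum>i. ediam (A i))"

definition hausdorff1_outer :: "'a::metric_space set \<Rightarrow> ennreal" where
  "hausdorff1_outer E = (SUP \<delta>\<in>{0<..}. hausdorff1_pre \<delta> E)"

(* measure_of yields the null measure unless the given set function is countably additive;
   emeasure_hausdorff1 below shows that on Borel sets this really is the Hausdorff measure. *)
definition hausdorff1 :: "'a::metric_space measure" where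
  "hausdorff1 = measure_of UNIV (sets borel) hausdorff1_outer"

lemma ediam_mono: "A \<subseteq> B \<Longrightarrow> ediam A \<le> ediam B"
  unfolding ediam_def by (intro SUP_mono) (meson SUP_subset_mono order_refl subset_iff)

lemma ediam_empty [simp]: "ediam {} = 0"
  by (simp add: ediam_def bot_ennreal)

lemma dist_le_ediam: "x \<in> E \<Longrightarrow> y \<in> E \<Longrightarrow> ennreal (dist x y) \<le> ediam E"
  unfolding ediam_def by (meson SUP_upper2 order_refl)

lemma hausdorff1_pre_le:
  "E \<subseteq> (\<Union>i. A i) \<Longrightarrow> (\<And>i. ediam (A i) \<le> ennreal \<delta>) \<Longrightarrow> hausdorff1_pre \<delta> E \<le> (\<Sum>i. ediam (A i))"
  unfolding hausdorff1_pre_def by (rule INF_lower) auto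

lemma hausdorff1_pre_mono: "A \<subseteq> B \<Longrightarrow> hausdorff1_pre \<delta> A \<le> hausdorff1_pre \<delta> B"
  unfolding hausdorff1_pre_def by (rule INF_superset_mono) auto

lemma hausdorff1_pre_antimono:
  "\<delta> \<le> \<epsilon> \<Longrightarrow> hausdorff1_pre \<epsilon> A \<le> hausdorff1_pre \<delta> A"
  unfolding hausdorff1_pre_def
  by (rule INF_superset_mono) (auto intro: order_trans ennreal_leI)

lemma hausdorff1_pre_empty [simp]: "hausdorff1_pre \<delta> {} = 0"
  using hausdorff1_pre_le[of "{}" "\<lambda>_. {}" \<delta>] by simp

lemma hausdorff1_pre_subadditive:
  "hausdorff1_pre \<delta> (\<Union>i. A i) \<le> (\<Sum>i. hausdorff1_pre \<delta> (A i))"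
proof (rule ennreal_le_epsilon)
  fix e :: real assume e: "0 < e" and fin: "(\<Sum>n. hausdorff1_pre \<delta> (A n)) < top"
  have *: "hausdorff1_pre \<delta> (A n) < hausdorff1_pre \<delta> (A n) + e * (1/2)^Suc n" for n
    using fin e by (auto simp add: less_top dest!: ennreal_suminf_lessD)
  have "\<exists>B :: nat \<Rightarrow> 'a set. A n \<subseteq> (\<Union>i. B i) \<and> (\<forall>i. ediam (B i) \<le> ennreal \<delta>) \<and>
      (\<Sum>i. ediam (B i)) \<le> hausdorff1_pre \<delta> (A n) + e * (1/2)^Suc n" for n
  proof -
    obtain B :: "nat \<Rightarrow> 'a set" where "A n \<subseteq> (\<Union>i. B i)" "\<forall>i. ediam (B i) \<le> ennreal \<delta>"
      "(\<Sum>i. ediam (B i)) < hausdorff1_pre \<delta> (A n) + e * (1/2)^Suc n"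
      using *[of n] unfolding hausdorff1_pre_def[of \<delta> "A n"] INF_less_iff by auto
    then show ?thesis by (intro exI[of _ B]) auto
  qed
  then obtain B :: "nat \<Rightarrow> nat \<Rightarrow> 'a set" where B: "\<And>n. A n \<subseteq> (\<Union>i. B n i)"
      "\<And>n i. ediam (B n i) \<le> ennreal \<delta>"
      "\<And>n. (\<Sum>i. ediam (B n i)) \<le> hausdorff1_pre \<delta> (A n) + e * (1/2)^Suc n"
    by metis
  define C where "C = case_prod B o prod_decode"
  have "(\<Union>i. A i) \<subseteq> (\<Union>i. C i)"
    using B(1) by (auto simp add: C_def subset_eq) (metis prod.case prod_encode_inverse)
  then have "hausdorff1_pre \<delta> (\<Union>i. A i) \<le> (\<Sum>i. ediam (C i))"
    by (rule hausdorff1_pre_le) (auto simp: C_def split_def B)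
  also have "\<dots> = (\<Sum>n. \<Sum>i. ediam (B n i))"
    using suminf_ennreal_2dimen[of "\<lambda>n. \<Sum>i. ediam (B n i)" "\<lambda>(n,i). ediam (B n i)"]
    by (simp add: C_def comp_def split_def)
  also have "\<dots> \<le> (\<Sum>n. hausdorff1_pre \<delta> (A n) + e * (1/2) ^ Suc n)"
    by (intro suminf_le allI B) auto
  also have "\<dots> = (\<Sum>n. hausdorff1_pre \<delta> (A n)) + (\<Sum>n. ennreal e * ennreal ((1/2) ^ Suc n))"
    using \<open>0 < e\<close> by (subst suminf_add[symmetric])
      (auto simp del: ennreal_suminf_cmult simp add: ennreal_mult[symmetric])
  also have "\<dots> = (\<Sum>n. hausdorff1_pre \<delta> (A n)) + e"
    unfolding ennreal_suminf_cmult
    by (subst suminf_ennreal_eq[OF zero_le_power power_half_series]) auto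
  finally show "hausdorff1_pre \<delta> (\<Union>i. A i) \<le> (\<Sum>n. hausdorff1_pre \<delta> (A n)) + e" .
qed

lemma hausdorff1_pre_le_outer: "0 < \<delta> \<Longrightarrow> hausdorff1_pre \<delta> A \<le> hausdorff1_outer A"
  unfolding hausdorff1_outer_def by (rule SUP_upper) auto

lemma hausdorff1_outer_mono: "A \<subseteq> B \<Longrightarrow> hausdorff1_outer A \<le> hausdorff1_outer B"
  unfolding hausdorff1_outer_def by (intro SUP_mono) (auto intro: hausdorff1_pre_mono)

lemma hausdorff1_outer_empty [simp]: "hausdorff1_outer {} = 0"
  unfolding hausdorff1_outer_def by simp

lemma hausdorff1_outer_subadditive:
  "hausdorff1_outer (\<Union>i. A i) \<le> (\<Sum>i. hausdorff1_outer (A i))"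
  unfolding hausdorff1_outer_def[of "\<Union>i. A i"]
proof (rule SUP_least)
  fix \<delta> :: real assume "\<delta> \<in> {0<..}"
  then show "hausdorff1_pre \<delta> (\<Union>i. A i) \<le> (\<Sum>i. hausdorff1_outer (A i))"
    by (intro order_trans[OF hausdorff1_pre_subadditive] suminf_le hausdorff1_pre_le_outer) auto
qed

lemma hausdorff1_outer_Un: "hausdorff1_outer (A \<union> B) \<le> hausdorff1_outer A + hausdorff1_outer B"
proof -
  have "(\<Union>i. binaryset A B i) = A \<union> B" by (rule UN_binaryset_eq)
  moreover have "(\<Sum>i. hausdorff1_outer (binaryset A B i)) = hausdorff1_outer A + hausdorff1_outer B"
    by (rule suminf_binaryset_eq) simp
  ultimately show ?thesis using hausdorff1_outer_subadditive[of "binaryset A B"] by simp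
qed

lemma hausdorff1_outer_separated:
  fixes A B :: "'a::metric_space set"
  assumes d: "0 < d" and sep: "\<And>x y. x \<in> A \<Longrightarrow> y \<in> B \<Longrightarrow> d \<le> dist x y"
  shows "hausdorff1_outer A + hausdorff1_outer B \<le> hausdorff1_outer (A \<union> B)"
proof -
  have main: "hausdorff1_pre a A + hausdorff1_pre b B \<le> hausdorff1_outer (A \<union> B)"
    if ab: "0 < a" "0 < b" for a b
  proof -
    define \<delta> where "\<delta> = min (min a b) (d/2)"
    have \<delta>: "0 < \<delta>" "\<delta> \<le> a" "\<delta> \<le> b" "\<delta> < d" using ab d by (auto simp: \<delta>_def min_def)
    have "hausdorff1_pre \<delta> A + hausdorff1_pre \<delta> B \<le> hausdorff1_pre \<delta> (A \<union> B)"
      unfolding hausdorff1_pre_def[of \<delta> "A \<union> B"]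
    proof (rule INF_greatest)
      fix C :: "nat \<Rightarrow> 'a set"
      assume "C \<in> {C. A \<union> B \<subseteq> (\<Union>i. C i) \<and> (\<forall>i. ediam (C i) \<le> ennreal \<delta>)}"
      then have C: "A \<union> B \<subseteq> (\<Union>i. C i)" "\<And>i. ediam (C i) \<le> ennreal \<delta>" by auto
      have split: "ediam (C i \<inter> A) + ediam (C i \<inter> B) \<le> ediam (C i)" for i
      proof -
        have "C i \<inter> A = {} \<or> C i \<inter> B = {}"
        proof (rule ccontr)
          assume "\<not> (C i \<inter> A = {} \<or> C i \<inter> B = {})"
          then obtain x y where "x \<in> C i" "x \<in> A" "y \<in> C i" "y \<in> B" by auto
          then have "d \<le> dist x y" "ennreal (dist x y) \<le> ennreal \<delta>"
            using sep C(2)[of i] dist_le_ediam order_trans by blast+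
          then show False using \<delta> by (simp add: ennreal_le_iff)
        qed
        then show ?thesis by (auto intro: ediam_mono)
      qed
      have "hausdorff1_pre \<delta> A + hausdorff1_pre \<delta> B
          \<le> (\<Sum>i. ediam (C i \<inter> A)) + (\<Sum>i. ediam (C i \<inter> B))"
        using C by (intro add_mono hausdorff1_pre_le)
          (auto intro: order_trans[OF ediam_mono[OF Int_lower1]])
      also have "\<dots> = (\<Sum>i. ediam (C i \<inter> A) + ediam (C i \<inter> B))"
        by (rule suminf_add) auto
      also have "\<dots> \<le> (\<Sum>i. ediam (C i))"
        by (intro suminf_le split) auto
      finally show "hausdorff1_pre \<delta> A + hausdorff1_pre \<delta> B \<le> (\<Sum>i. ediam (C i))" .
    qed
    moreover have "hausdorff1_pre a A + hausdorff1_pre b B \<le> hausdorff1_pre \<delta> A + hausdorff1_pre \<delta> B"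
      using \<delta> by (intro add_mono hausdorff1_pre_antimono)
    ultimately show ?thesis
      using hausdorff1_pre_le_outer[OF \<delta>(1), of "A \<union> B"] by (meson order_trans)
  qed
  have ne: "{0::real<..} \<noteq> {}" by (auto intro: zero_less_one)
  have 1: "hausdorff1_pre a A + hausdorff1_outer B \<le> hausdorff1_outer (A \<union> B)" if "0 < a" for a
    unfolding hausdorff1_outer_def[of B] ennreal_SUP_add_right[OF ne]
    by (rule SUP_least) (use main that in auto)
  show ?thesis
    unfolding hausdorff1_outer_def[of A] ennreal_SUP_add_left[OF ne, symmetric]
    by (rule SUP_least) (use 1 in auto)
qed

lemma hausdorff1_outer_closed_split:
  fixes C T :: "'a::metric_space set"
  assumes "closed C"
  shows "hausdorff1_outer (T \<inter> C) + hausdorff1_outer (T - C) \<le> hausdorff1_outer T"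
proof (cases "C = {}")
  case False
  define F where "F n = {x\<in>T. 1 / real (Suc n) \<le> infdist x C}" for n
  define R where "R n = F (Suc n) - F n" for n
  define s where "s = (SUP n. hausdorff1_outer (F n))"
  have Fs: "hausdorff1_outer (F n) \<le> s" for n unfolding s_def by (rule SUP_upper) auto
  have step: "hausdorff1_outer (F n) + hausdorff1_outer (R (Suc n)) \<le> hausdorff1_outer (F (Suc (Suc n)))" for n
  proof -
    let ?d = "1 / real (Suc n) - 1 / real (Suc (Suc n))"
    have "hausdorff1_outer (F n) + hausdorff1_outer (R (Suc n)) \<le> hausdorff1_outer (F n \<union> R (Suc n))"
    proof (rule hausdorff1_outer_separated)
      show "0 < ?d" using frac_less2[of 1 1 "real (Suc n)" "real (Suc (Suc n))"] by simp
      fix x y assume "x \<in> F n" "y \<in> R (Suc n)"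
      then have "1 / real (Suc n) \<le> infdist x C" "infdist y C < 1 / real (Suc (Suc n))"
        by (auto simp: F_def R_def)
      then show "?d \<le> dist x y" using infdist_triangle[of x C y] by linarith
    qed
    also have "F n \<union> R (Suc n) \<subseteq> F (Suc (Suc n))"
    proof -
      have "F n \<subseteq> F (Suc (Suc n))"
      proof
        fix x assume "x \<in> F n"
        moreover have "1 / real (Suc (Suc (Suc n))) \<le> 1 / real (Suc n)" by (simp add: field_simps)
        ultimately show "x \<in> F (Suc (Suc n))" unfolding F_def by force
      qed
      then show ?thesis by (auto simp: R_def)
    qed
    then have "hausdorff1_outer (F n \<union> R (Suc n)) \<le> hausdorff1_outer (F (Suc (Suc n)))"
      by (rule hausdorff1_outer_mono)
    finally show ?thesis .
  qed
  have alt: "(\<Sum>k<m. hausdorff1_outer (R (Suc (2*k+j)))) \<le> hausdorff1_outer (F (2*m+j))" for m j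
  proof (induction m)
    case (Suc m)
    have "(\<Sum>k<Suc m. hausdorff1_outer (R (Suc (2*k+j))))
        \<le> hausdorff1_outer (F (2*m+j)) + hausdorff1_outer (R (Suc (2*m+j)))"
      using Suc by (simp add: add_right_mono)
    also have "\<dots> \<le> hausdorff1_outer (F (2*Suc m+j))" using step[of "2*m+j"] by simp
    finally show ?case .
  qed simp
  have both: "(\<Sum>k<2*m. hausdorff1_outer (R (Suc k)))
      = (\<Sum>k<m. hausdorff1_outer (R (Suc (2*k)))) + (\<Sum>k<m. hausdorff1_outer (R (Suc (2*k+1))))" for m
    by (induction m) (simp_all add: algebra_simps)
  have sumR: "(\<Sum>k. hausdorff1_outer (R (Suc k))) \<le> s + s"
  proof (rule suminf_le_const[OF summableI])
    fix n
    have "(\<Sum>k<n. hausdorff1_outer (R (Suc k))) \<le> (\<Sum>k<2*n. hausdorff1_outer (R (Suc k)))"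
      by (rule sum_mono2) auto
    also have "\<dots> \<le> s + s"
      unfolding both using alt[of 0 n] alt[of 1 n] Fs by (intro add_mono) (auto intro: order_trans)
    finally show "(\<Sum>k<n. hausdorff1_outer (R (Suc k))) \<le> s + s" .
  qed
  have cover: "T - C \<subseteq> F (Suc n) \<union> (\<Union>k. R (Suc (k + n)))" for n
  proof
    fix x assume x: "x \<in> T - C"
    then have "0 < infdist x C"
      using \<open>closed C\<close> False by (metis DiffD2 in_closed_iff_infdist_zero infdist_nonneg less_eq_real_def)
    then obtain m where "1 / real (Suc m) < infdist x C" by (metis nat_approx_posE)
    then have ex: "\<exists>m. x \<in> F m" using x by (auto simp: F_def intro!: exI[of _ m])
    show "x \<in> F (Suc n) \<union> (\<Union>k. R (Suc (k + n)))"
    proof (cases "x \<in> F (Suc n)")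
      case nF: False
      define k where "k = (LEAST m. x \<in> F m)"
      have k: "x \<in> F k" "\<And>i. i < k \<Longrightarrow> x \<notin> F i"
        using ex unfolding k_def by (auto intro: LeastI_ex dest: not_less_Least)
      have "Suc n < k"
      proof (rule ccontr)
        assume "\<not> Suc n < k"
        then have "1 / real (Suc (Suc n)) \<le> 1 / real (Suc k)" by (simp add: field_simps)
        then have "x \<in> F (Suc n)" using k(1) by (auto simp: F_def)
        then show False using nF by simp
      qed
      then obtain i where i: "k = Suc (Suc (i + n))"
        by (metis Suc_lessE add.commute add_Suc less_imp_add_positive less_iff_Suc_add)
      then have "x \<in> R (Suc (i + n))" using k by (auto simp: R_def)
      then show ?thesis by auto
    qed auto
  qed
  have TC: "hausdorff1_outer (T - C) \<le> s"
  proof (rule ennreal_le_epsilon)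
    fix e :: real assume e: "0 < e" and fin: "s < top"
    let ?f = "\<lambda>k. hausdorff1_outer (R (Suc k))"
    have ftop: "(\<Sum>k. ?f k) < top" using sumR fin
      by (metis ennreal_add_eq_top le_less_trans less_top)
    have tail: "(\<lambda>n. \<Sum>k. ?f (k + n)) \<longlonglongrightarrow> 0"
    proof -
      define r where "r k = enn2real (?f k)" for k
      have fr: "?f k = ennreal (r k)" "0 \<le> r k" for k
        using ennreal_suminf_lessD[OF ftop, of k] by (auto simp: r_def)
      have sr: "summable r"
        using ftop fr by (intro summable_suminf_not_top) auto
      have "(\<lambda>n. \<Sum>k. r (k + n)) \<longlonglongrightarrow> 0" using suminf_exist_split2[OF sr] .
      then have "(\<lambda>n. ennreal (\<Sum>k. r (k + n))) \<longlonglongrightarrow> ennreal 0" by (rule tendsto_ennrealI)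
      moreover have "ennreal (\<Sum>k. r (k + n)) = (\<Sum>k. ?f (k + n))" for n
        unfolding fr using fr sr by (intro suminf_ennreal2[symmetric]) (auto simp: summable_iff_shift)
      ultimately show ?thesis by simp
    qed
    have "\<forall>\<^sub>F n in sequentially. (\<Sum>k. ?f (k + n)) < ennreal e"
      by (rule order_tendstoD(2)[OF tail]) (use e in auto)
    then obtain n where n: "(\<Sum>k. ?f (k + n)) < ennreal e" by (auto simp: eventually_sequentially)
    have "hausdorff1_outer (T - C) \<le> hausdorff1_outer (F (Suc n) \<union> (\<Union>k. R (Suc (k + n))))"
      by (rule hausdorff1_outer_mono[OF cover])
    also have "\<dots> \<le> hausdorff1_outer (F (Suc n)) + (\<Sum>k. ?f (k + n))"
      by (rule order_trans[OF hausdorff1_outer_Un add_left_mono[OF hausdorff1_outer_subadditive]])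
    also have "\<dots> \<le> s + ennreal e" using n Fs by (intro add_mono) auto
    finally show "hausdorff1_outer (T - C) \<le> s + ennreal e" .
  qed
  have "hausdorff1_outer (T \<inter> C) + hausdorff1_outer (F n) \<le> hausdorff1_outer T" for n
  proof -
    have "hausdorff1_outer (T \<inter> C) + hausdorff1_outer (F n) \<le> hausdorff1_outer ((T \<inter> C) \<union> F n)"
    proof (rule hausdorff1_outer_separated)
      show "0 < 1 / real (Suc n)" by simp
      fix x y assume "x \<in> T \<inter> C" "y \<in> F n"
      then have "1 / real (Suc n) \<le> infdist y C" "infdist y C \<le> dist y x"
        by (auto simp: F_def intro: infdist_le)
      then show "1 / real (Suc n) \<le> dist x y" by (simp add: dist_commute)
    qed
    also have "\<dots> \<le> hausdorff1_outer T"
      by (rule hausdorff1_outer_mono) (auto simp: F_def)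
    finally show ?thesis .
  qed
  then have "hausdorff1_outer (T \<inter> C) + s \<le> hausdorff1_outer T"
    unfolding s_def by (subst ennreal_SUP_add_right) (auto intro: SUP_least)
  with TC show ?thesis by (meson add_left_mono order_trans)
qed simp

lemma measure_space_hausdorff1: "measure_space UNIV (sets borel) hausdorff1_outer"
proof -
  interpret P: sigma_algebra UNIV "Pow (UNIV :: 'a set)" by (rule sigma_algebra_Pow)
  let ?L = "lambda_system UNIV (Pow UNIV) (hausdorff1_outer :: 'a set \<Rightarrow> ennreal)"
  have oms: "outer_measure_space (Pow UNIV) (hausdorff1_outer :: 'a set \<Rightarrow> ennreal)"
    by (auto simp: outer_measure_space_def positive_def increasing_def countably_subadditive_def
        intro: hausdorff1_outer_mono hausdorff1_outer_subadditive)
  have ms: "measure_space UNIV ?L hausdorff1_outer" by (rule P.caratheodory_lemma[OF oms])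
  then interpret L: sigma_algebra UNIV ?L by (simp add: measure_space_def)
  have "C \<in> ?L" if "closed C" for C :: "'a set"
  proof -
    have "hausdorff1_outer (T \<inter> C) + hausdorff1_outer (T - C) = hausdorff1_outer T" for T
    proof (rule antisym[OF hausdorff1_outer_closed_split[OF that]])
      show "hausdorff1_outer T \<le> hausdorff1_outer (T \<inter> C) + hausdorff1_outer (T - C)"
        using hausdorff1_outer_Un[of "T \<inter> C" "T - C"] by (simp add: Int_Diff_Un)
    qed
    then show ?thesis unfolding P.lambda_system_eq by simp
  qed
  then have "sigma_sets UNIV (Collect closed) \<subseteq> ?L"
    by (intro L.sigma_sets_subset) auto
  then have "sets borel \<subseteq> ?L"
    by (simp add: borel_eq_closed)
  with ms show ?thesis
    using sets.sigma_algebra_axioms[of "borel :: 'a measure"]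
    by (auto simp: measure_space_def positive_def countably_additive_def subset_eq image_subset_iff)
qed

lemma sets_hausdorff1 [simp, measurable_cong]: "sets hausdorff1 = sets borel"
  using sets.sigma_sets_eq[of borel] by (simp add: hausdorff1_def)

lemma space_hausdorff1 [simp]: "space hausdorff1 = UNIV"
  by (simp add: hausdorff1_def)

lemma emeasure_hausdorff1: "A \<in> sets borel \<Longrightarrow> emeasure hausdorff1 A = hausdorff1_outer A"
  using measure_space_hausdorff1 unfolding hausdorff1_def measure_space_def
  by (intro emeasure_measure_of_sigma) auto


section \<open>Upper gradients and spaces of bounded geometry\<close>

definition continuum :: "'a::metric_space set \<Rightarrow> bool" where
  "continuum \<gamma> \<longleftrightarrow> compact \<gamma> \<and> connected \<gamma>"

definition rectifiable_continuum :: "'a::metric_space set \<Rightarrow> bool" where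
  "rectifiable_continuum \<gamma> \<longleftrightarrow> continuum \<gamma> \<and> emeasure hausdorff1 \<gamma> < \<infinity>"

definition upper_gradient :: "('a::metric_space \<Rightarrow> ennreal) \<Rightarrow> ('a \<Rightarrow> real) \<Rightarrow> bool" where
  "upper_gradient g u \<longleftrightarrow> g \<in> borel_measurable borel \<and>
     (\<forall>\<gamma> x y. rectifiable_continuum \<gamma> \<and> x \<in> \<gamma> \<and> y \<in> \<gamma> \<longrightarrow>
        ennreal \<bar>u x - u y\<bar> \<le> (\<integral>\<^sup>+z\<in>\<gamma>. g z \<partial>hausdorff1))"

definition locally_integrable :: "'a::metric_space measure \<Rightarrow> ('a \<Rightarrow> real) \<Rightarrow> bool" where
  "locally_integrable \<mu> u \<longleftrightarrow> u \<in> borel_measurable \<mu> \<and>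
     (\<forall>x. \<exists>r>0. set_integrable \<mu> (ball x r) u)"

definition average :: "'a measure \<Rightarrow> 'a set \<Rightarrow> ('a \<Rightarrow> real) \<Rightarrow> real" where
  "average \<mu> B u = (LINT y:B|\<mu>. u y) / measure \<mu> B"

(* t^p for t in [0,\<infinity>] and p > 0 *)
definition ennpowr :: "ennreal \<Rightarrow> real \<Rightarrow> ennreal" where
  "ennpowr t p = (if t = \<infinity> then \<infinity> else ennreal (enn2real t powr p))"

definition poincare_inequality :: "real \<Rightarrow> 'a::metric_space measure \<Rightarrow> bool" where
  "poincare_inequality Q \<mu> \<longleftrightarrow>
     (\<exists>C \<Lambda>. 1 \<le> C \<and> 1 \<le> \<Lambda> \<and>
       (\<forall>x r u g. 0 < r \<and> locally_integrable \<mu> u \<and> upper_gradient g u \<longrightarrow>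
          (\<integral>\<^sup>+y\<in>ball x r. ennreal \<bar>u y - average \<mu> (ball x r) u\<bar> \<partial>\<mu>) / emeasure \<mu> (ball x r)
          \<le> ennreal (C * r) *
            ennpowr ((\<integral>\<^sup>+y\<in>ball x (\<Lambda> * r). ennpowr (g y) Q \<partial>\<mu>) / emeasure \<mu> (ball x (\<Lambda> * r))) (1 / Q)))"

definition ahlfors_regular :: "real \<Rightarrow> 'a::metric_space measure \<Rightarrow> bool" where
  "ahlfors_regular Q \<mu> \<longleftrightarrow>
     (\<exists>c C. 0 < c \<and> 0 < C \<and>
       (\<forall>x r. 0 < r \<and> ennreal r \<le> ediam (UNIV :: 'a set) \<longrightarrow>
          ennreal (c * r powr Q) \<le> emeasure \<mu> (ball x r) \<and>
          emeasure \<mu> (ball x r) \<le> ennreal (C * r powr Q)))"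

(* The space X is the whole type 'a.  Properness: closed balls are compact. *)
definition bounded_geometry :: "real \<Rightarrow> 'a::metric_space measure \<Rightarrow> bool" where
  "bounded_geometry Q \<mu> \<longleftrightarrow>
     (\<forall>(x::'a) r. compact (cball x r)) \<and> path_connected (UNIV :: 'a set) \<and>
     sets \<mu> = sets borel \<and> ahlfors_regular Q \<mu> \<and> poincare_inequality Q \<mu>"

(* Restricting to 0 \<le> \<tau> loses nothing, since enlarging \<tau> only weakens the requirement;
   it keeps "ennreal \<tau>" from truncating. *)
definition A_infinity_on_curves :: "'a::metric_space measure \<Rightarrow> bool" where
  "A_infinity_on_curves \<mu> \<longleftrightarrow>
     (\<exists>\<tau> \<theta>. 0 \<le> \<tau> \<and> \<tau> < 1 \<and> 0 < \<theta> \<and>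
       (\<forall>x r S. 0 < r \<and> ennreal r \<le> ediam (UNIV :: 'a set) \<and> S \<in> sets borel \<and> S \<subseteq> ball x r \<and>
          ennreal \<tau> * emeasure \<mu> (ball x r) < emeasure \<mu> S \<longrightarrow>
          (\<exists>\<gamma>. continuum \<gamma> \<and> \<gamma> \<subseteq> ball x r \<and> emeasure hausdorff1 \<gamma> \<le> ennreal r \<and>
             ennreal (\<theta> * r) \<le> hausdorff1_content (\<gamma> \<inter> S))))"

end

theory Submission
  imports Defs
begin

text \<open>
Let \<open>S\<close> fill most of a ball of radius \<open>r\<close>.  The aim is a continuum \<open>\<gamma>\<close> that has length at most \<open>r\<close>
and diameter comparable to \<open>r\<close>, and that spends little length outside \<open>S\<close>.  This is enough: the
content of a connected set is at least its diameter (\<open>dist_le_hausdorff1_content_connected\<close>), content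
is subadditive and is dominated by Hausdorff measure, so the content of \<open>\<gamma> \<inter> S\<close> is at least the
diameter of \<open>\<gamma>\<close> minus the measure of \<open>\<gamma> - S\<close>.

By inner regularity, shrink \<open>S\<close> to a closed set, so that its complement \<open>U\<close> in the ball is open and
still small.  Give \<open>U\<close> a large weight \<open>W\<close> and the rest of the space the weight \<open>1\<close>.  On a
smaller concentric ball of radius \<open>s\<close> choose two balls \<open>A\<close> and \<open>A'\<close> of radius \<open>s/8\<close> whose centres
have distance \<open>s/2\<close>.  The Poincare inequality, applied to the weighted distance from \<open>A\<close>, shows that \<open>A\<close> and
\<open>A'\<close> can be joined at a weighted cost of at most a constant multiple \<open>L * s\<close>, where \<open>L\<close> does not depend on
\<open>W\<close> provided that \<open>W powr Q\<close> times the measure of \<open>U\<close> is small (\<open>poincare_short_chain\<close>).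
A path of weighted cost \<open>L * s\<close> has length at most \<open>L * s\<close> and spends length at most \<open>L * s / W\<close> in \<open>U\<close>; take
\<open>W\<close> large compared with \<open>L\<close>, and then \<open>U\<close> small compared with \<open>W\<close>.

The weighted distance is defined with chains of steps shorter than \<open>\<epsilon>\<close> rather than with curves,
which makes it continuous, hence an admissible test function, and its upper gradient is found
by covering arguments alone (\<open>upper_gradient_two_valued\<close>).  As \<open>\<epsilon>\<close> tends to \<open>0\<close>, the chains,
parametrized by their cost, have a cluster point that is a 1-Lipschitz curve, because the space is proper; where
this curve runs in the open set \<open>U\<close> its speed is at most \<open>1 / W\<close>, and this gives both bounds on length
(\<open>short_chains_limit_curve\<close>).
\<close>

section \<open>Hausdorff content\<close>

lemma hausdorff1_content_le:
  "E \<subseteq> (\<Union>i. A i) \<Longrightarrow> hausdorff1_content E \<le> (\<Sum>i. ediam (A i))"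
  unfolding hausdorff1_content_def by (rule INF_lower) auto

lemma hausdorff1_content_mono: "A \<subseteq> B \<Longrightarrow> hausdorff1_content A \<le> hausdorff1_content B"
  unfolding hausdorff1_content_def by (rule INF_superset_mono) auto

lemma hausdorff1_content_Un:
  "hausdorff1_content (A \<union> B) \<le> hausdorff1_content A + hausdorff1_content (B :: 'a::metric_space set)"
proof (rule ennreal_le_epsilon)
  fix e :: real
  assume e: "0 < e" and fin: "hausdorff1_content A + hausdorff1_content B < top"
  have near: "\<exists>C :: nat \<Rightarrow> 'a set. E \<subseteq> (\<Union>i. C i) \<and> (\<Sum>i. ediam (C i)) < hausdorff1_content E + ennreal (e/2)"
    if "hausdorff1_content E < top" for E :: "'a set"
  proof -
    have "hausdorff1_content E < hausdorff1_content E + ennreal (e/2)"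
      using that e by simp
    then show ?thesis
      unfolding hausdorff1_content_def[of E] INF_less_iff by auto
  qed
  obtain C where C: "A \<subseteq> (\<Union>i. C i)" "(\<Sum>i. ediam (C i)) < hausdorff1_content A + ennreal (e/2)"
    using near[of A] fin by (auto simp: less_top)
  obtain D where D: "B \<subseteq> (\<Union>i. D i)" "(\<Sum>i. ediam (D i)) < hausdorff1_content B + ennreal (e/2)"
    using near[of B] fin by (auto simp: less_top)
  define E where "E = (\<lambda>n i. if n = 0 then C i else if n = Suc 0 then D i else {})"
  have "A \<union> B \<subseteq> (\<Union>i. (case_prod E \<circ> prod_decode) i)"
  proof
    fix x assume "x \<in> A \<union> B"
    then obtain n i where "x \<in> E n i"
      using C(1) D(1) unfolding E_def by (metis UN_E Un_iff subsetD old.nat.distinct(2))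
    then have "x \<in> (case_prod E \<circ> prod_decode) (prod_encode (n, i))" by simp
    then show "x \<in> (\<Union>i. (case_prod E \<circ> prod_decode) i)" by blast
  qed
  then have "hausdorff1_content (A \<union> B) \<le> (\<Sum>k. ediam ((case_prod E \<circ> prod_decode) k))"
    by (rule hausdorff1_content_le)
  also have "\<dots> = (\<Sum>n. \<Sum>i. ediam (E n i))"
    using suminf_ennreal_2dimen[of "\<lambda>n. \<Sum>i. ediam (E n i)" "\<lambda>(n,i). ediam (E n i)"]
    by (simp add: comp_def split_def)
  also have "\<dots> = (\<Sum>n\<in>{0, Suc 0}. \<Sum>i. ediam (E n i))"
    by (rule suminf_finite) (auto simp: E_def)
  also have "\<dots> = (\<Sum>i. ediam (C i)) + (\<Sum>i. ediam (D i))" by (simp add: E_def)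
  also have "\<dots> \<le> (hausdorff1_content A + ennreal (e/2)) + (hausdorff1_content B + ennreal (e/2))"
    using C D by (intro add_mono) auto
  also have "\<dots> = hausdorff1_content A + hausdorff1_content B + ennreal (e/2 + e/2)"
    using e by (subst ennreal_plus) (auto simp: ac_simps)
  finally show "hausdorff1_content (A \<union> B) \<le> hausdorff1_content A + hausdorff1_content B + ennreal e"
    by simp
qed

lemma le_ennreal_mult_INF:
  fixes f :: "'b \<Rightarrow> ennreal"
  assumes "0 < L" and "\<And>i. i \<in> I \<Longrightarrow> X \<le> ennreal L * f i"
  shows "X \<le> ennreal L * (INF i\<in>I. f i)"
proof -
  have inv: "ennreal (1/L) * (ennreal L * Y) = Y" "ennreal L * (ennreal (1/L) * Y) = Y" for Y
    using \<open>0 < L\<close> by (simp_all add: mult.assoc[symmetric] ennreal_mult[symmetric])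
  have "ennreal (1/L) * X \<le> (INF i\<in>I. f i)"
  proof (rule INF_greatest)
    fix i assume "i \<in> I"
    then have "ennreal (1/L) * X \<le> ennreal (1/L) * (ennreal L * f i)"
      by (intro mult_left_mono assms) auto
    then show "ennreal (1/L) * X \<le> f i" by (simp only: inv)
  qed
  then have "ennreal L * (ennreal (1/L) * X) \<le> ennreal L * (INF i\<in>I. f i)"
    by (intro mult_left_mono) auto
  then show ?thesis by (simp only: inv)
qed

lemma hausdorff1_content_le_outer: "hausdorff1_content E \<le> hausdorff1_outer E"
proof -
  have "hausdorff1_content E \<le> hausdorff1_pre 1 E"
    unfolding hausdorff1_content_def hausdorff1_pre_def by (rule INF_superset_mono) auto
  also have "\<dots> \<le> hausdorff1_outer E" by (rule hausdorff1_pre_le_outer) simp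
  finally show ?thesis .
qed

lemma ediam_image_le:
  fixes f :: "'a::metric_space \<Rightarrow> 'b::metric_space"
  assumes "0 \<le> L" and "\<And>a b. a \<in> A \<Longrightarrow> b \<in> A \<Longrightarrow> dist (f a) (f b) \<le> L * dist a b"
  shows "ediam (f ` A) \<le> ennreal L * ediam A"
  unfolding ediam_def[of "f ` A"]
proof (intro SUP_least)
  fix x y assume xy: "x \<in> f ` A" "y \<in> f ` A"
  then obtain a b where ab: "a \<in> A" "b \<in> A" "x = f a" "y = f b" by auto
  have "ennreal (dist x y) \<le> ennreal (L * dist a b)" unfolding ab(3,4) by (intro ennreal_leI assms ab)
  also have "\<dots> = ennreal L * ennreal (dist a b)" using assms by (simp add: ennreal_mult)
  also have "\<dots> \<le> ennreal L * ediam A" using ab by (intro mult_left_mono dist_le_ediam) auto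
  finally show "ennreal (dist x y) \<le> ennreal L * ediam A" .
qed

lemma hausdorff1_content_image_le:
  fixes f :: "'a::metric_space \<Rightarrow> 'b::metric_space"
  assumes "0 < L" and lip: "\<And>a b. a \<in> A \<Longrightarrow> b \<in> A \<Longrightarrow> dist (f a) (f b) \<le> L * dist a b"
  shows "hausdorff1_content (f ` A) \<le> ennreal L * hausdorff1_content A"
proof -
  have "hausdorff1_content (f ` A) \<le> ennreal L * (\<Sum>i. ediam (C i))"
    if C: "A \<subseteq> (\<Union>i. C i)" for C :: "nat \<Rightarrow> 'a set"
  proof -
    have "hausdorff1_content (f ` A) \<le> (\<Sum>i. ediam (f ` (A \<inter> C i)))"
      using C by (intro hausdorff1_content_le) blast
    also have "\<dots> \<le> (\<Sum>i. ennreal L * ediam (C i))"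
    proof (intro suminf_le)
      fix i
      have "ediam (f ` (A \<inter> C i)) \<le> ennreal L * ediam (A \<inter> C i)"
        using assms by (intro ediam_image_le) auto
      also have "\<dots> \<le> ennreal L * ediam (C i)" by (intro mult_left_mono ediam_mono) auto
      finally show "ediam (f ` (A \<inter> C i)) \<le> ennreal L * ediam (C i)" .
    qed auto
    finally show ?thesis by simp
  qed
  then show ?thesis
    unfolding hausdorff1_content_def[of A]
    using \<open>0 < L\<close> by (auto intro!: le_ennreal_mult_INF)
qed

text \<open>Here \<open>f\<close> is controlled only at scale \<open>\<epsilon>\<close>.  The measure, unlike the content, can be computed with
covers by sets of diameter less than \<open>\<epsilon>\<close>, and on each such set \<open>f\<close> is Lipschitz.\<close>

lemma hausdorff1_content_image_le_outer:
  fixes f :: "'a::metric_space \<Rightarrow> 'b::metric_space"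
  assumes "0 < L" "0 < \<epsilon>"
    and lip: "\<And>a b. a \<in> A \<Longrightarrow> b \<in> A \<Longrightarrow> dist a b < \<epsilon> \<Longrightarrow> dist (f a) (f b) \<le> L * dist a b"
  shows "hausdorff1_content (f ` A) \<le> ennreal L * hausdorff1_outer A"
proof -
  have "hausdorff1_content (f ` A) \<le> ennreal L * (\<Sum>i. ediam (C i))"
    if C: "A \<subseteq> (\<Union>i. C i)" "\<And>i. ediam (C i) \<le> ennreal (\<epsilon>/2)" for C :: "nat \<Rightarrow> 'a set"
  proof -
    have "hausdorff1_content (f ` A) \<le> (\<Sum>i. ediam (f ` (A \<inter> C i)))"
      using C by (intro hausdorff1_content_le) blast
    also have "\<dots> \<le> (\<Sum>i. ennreal L * ediam (C i))"
    proof (intro suminf_le)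
      fix i
      have "ediam (f ` (A \<inter> C i)) \<le> ennreal L * ediam (A \<inter> C i)"
      proof (intro ediam_image_le)
        fix a b assume ab: "a \<in> A \<inter> C i" "b \<in> A \<inter> C i"
        then have "ennreal (dist a b) \<le> ennreal (\<epsilon>/2)"
          using C(2)[of i] dist_le_ediam[of a "C i" b] by (auto intro: order_trans)
        then have "dist a b < \<epsilon>" using \<open>0 < \<epsilon>\<close> by (simp add: ennreal_le_iff)
        then show "dist (f a) (f b) \<le> L * dist a b" using ab lip by auto
      qed (use assms in auto)
      also have "\<dots> \<le> ennreal L * ediam (C i)" by (intro mult_left_mono ediam_mono) auto
      finally show "ediam (f ` (A \<inter> C i)) \<le> ennreal L * ediam (C i)" .
    qed auto
    finally show ?thesis by simp
  qed
  then have "hausdorff1_content (f ` A) \<le> ennreal L * hausdorff1_pre (\<epsilon>/2) A"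
    unfolding hausdorff1_pre_def
    using \<open>0 < L\<close> by (auto intro!: le_ennreal_mult_INF)
  also have "\<dots> \<le> ennreal L * hausdorff1_outer A"
    using assms by (intro mult_left_mono hausdorff1_pre_le_outer) auto
  finally show ?thesis .
qed

text \<open>Content on the line dominates Lebesgue measure: a set of reals lies in the interval from its infimum
to its supremum, whose length is the diameter of the set, and Lebesgue measure is countably
subadditive.\<close>

lemma hausdorff1_content_interval:
  fixes a b :: real
  assumes "a \<le> b"
  shows "ennreal (b - a) \<le> hausdorff1_content {a..b}"
  unfolding hausdorff1_content_def
proof (rule INF_greatest)
  fix J :: "nat \<Rightarrow> real set"
  assume "J \<in> {J. {a..b} \<subseteq> (\<Union>i. J i)}"
  then have J: "{a..b} \<subseteq> (\<Union>i. J i)" by simp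
  have "\<exists>K\<in>sets lborel. J i \<subseteq> K \<and> emeasure lborel K \<le> ediam (J i)" for i
  proof (cases "J i = {} \<or> ediam (J i) = \<infinity>")
    case True
    then show ?thesis by (auto intro: bexI[of _ "{}"] bexI[of _ UNIV])
  next
    case False
    then obtain d x where d: "ediam (J i) = ennreal d" "0 \<le> d" and x: "x \<in> J i"
      by (metis all_not_in_conv ennreal_cases infinity_ennreal_def)
    have near: "\<bar>y - z\<bar> \<le> d" if "y \<in> J i" "z \<in> J i" for y z
      using dist_le_ediam[OF that] d by (simp add: dist_real_def ennreal_le_iff)
    have bdd: "bdd_below (J i)" "bdd_above (J i)"
      using near[OF _ x] by (auto intro!: bdd_belowI[of _ "x - d"] bdd_aboveI[of _ "x + d"] simp: abs_le_iff algebra_simps)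
    have "Sup (J i) \<le> Inf (J i) + d"
    proof (rule cSup_least)
      fix y assume y: "y \<in> J i"
      have "y - d \<le> Inf (J i)"
        by (rule cInf_greatest) (use x near[OF y] in \<open>force simp: abs_le_iff\<close>)+
      then show "y \<le> Inf (J i) + d" by simp
    qed (use x in auto)
    moreover have "Inf (J i) \<le> Sup (J i)"
      using x bdd by (meson cInf_lower cSup_upper order_trans)
    moreover have "J i \<subseteq> {Inf (J i)..Sup (J i)}"
      using bdd by (auto intro: cInf_lower cSup_upper)
    ultimately show ?thesis
      using d by (intro bexI[of _ "{Inf (J i)..Sup (J i)}"]) (auto intro!: ennreal_leI)
  qed
  then obtain K where K: "\<And>i. K i \<in> sets lborel" "\<And>i. J i \<subseteq> K i"
    "\<And>i. emeasure lborel (K i) \<le> ediam (J i)" by metis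
  have "ennreal (b - a) = emeasure lborel {a..b}" using assms by simp
  also have "\<dots> \<le> emeasure lborel (\<Union>i. K i)"
  proof (rule emeasure_mono)
    show "{a..b} \<subseteq> (\<Union>i. K i)"
      using J SUP_mono[of UNIV UNIV J K] K(2) by (meson UNIV_I order_trans)
    show "(\<Union>i. K i) \<in> sets lborel" using K(1) by (rule sets.countable_UN[OF image_subsetI])
  qed
  also have "\<dots> \<le> (\<Sum>i. emeasure lborel (K i))"
    using K by (intro emeasure_subadditive_countably) auto
  also have "\<dots> \<le> (\<Sum>i. ediam (J i))" by (intro suminf_le K) auto
  finally show "ennreal (b - a) \<le> (\<Sum>i. ediam (J i))" .
qed

lemma hausdorff1_content_connected_real:
  fixes I :: "real set"
  assumes "connected I" "a \<in> I" "b \<in> I"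
  shows "ennreal \<bar>a - b\<bar> \<le> hausdorff1_content I"
proof -
  have "{min a b..max a b} \<subseteq> I"
    using assms by (intro connected_contains_Icc) (auto simp: min_def max_def)
  then have "hausdorff1_content {min a b..max a b} \<le> hausdorff1_content I"
    by (rule hausdorff1_content_mono)
  moreover have "ennreal (max a b - min a b) \<le> hausdorff1_content {min a b..max a b}"
    by (rule hausdorff1_content_interval) auto
  moreover have "max a b - min a b = \<bar>a - b\<bar>" by auto
  ultimately show ?thesis by (metis order_trans)
qed

text \<open>The distance to \<open>x\<close> is a 1-Lipschitz map that sends \<open>\<gamma>\<close> to a connected set of reals containing
\<open>0\<close> and \<open>dist x y\<close>; so a connected set cannot be covered by sets of small total diameter.\<close>

lemma dist_le_hausdorff1_content_connected:
  fixes \<gamma> :: "'a::metric_space set"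
  assumes "connected \<gamma>" "x \<in> \<gamma>" "y \<in> \<gamma>"
  shows "ennreal (dist x y) \<le> hausdorff1_content \<gamma>"
proof -
  have "connected (dist x ` \<gamma>)"
    using assms(1) by (intro connected_continuous_image continuous_intros)
  then have "ennreal \<bar>dist x x - dist x y\<bar> \<le> hausdorff1_content (dist x ` \<gamma>)"
    using assms by (intro hausdorff1_content_connected_real) auto
  also have "\<dots> \<le> ennreal 1 * hausdorff1_content \<gamma>"
  proof (rule hausdorff1_content_image_le)
    fix a b show "dist (dist x a) (dist x b) \<le> 1 * dist a b"
      using abs_dist_diff_le[of a x b] by (simp add: dist_real_def dist_commute[of a x])
  qed simp
  finally show ?thesis by simp
qed

section \<open>Upper gradients\<close>

text \<open>A function that at scale \<open>\<epsilon>\<close> is \<open>W\<close>-Lipschitz everywhere and 1-Lipschitz off \<open>U\<close> has the upper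
gradient with values \<open>W\<close> on \<open>U\<close> and \<open>1\<close> elsewhere.  No parametrization of the continuum \<open>\<gamma>\<close> is
needed: \<open>u ` \<gamma>\<close> is connected, so its content bounds the oscillation of \<open>u\<close>, and the content of each
of the pieces \<open>u ` (\<gamma> - U)\<close> and \<open>u ` (\<gamma> \<inter> U)\<close> is at most the Lipschitz constant on that piece times
its Hausdorff measure.\<close>

lemma upper_gradient_two_valued:
  fixes u :: "'a::metric_space \<Rightarrow> real" and U :: "'a set"
  assumes "0 < \<epsilon>" "0 < W" and U: "U \<in> sets borel"
    and inU: "\<And>a b. dist a b < \<epsilon> \<Longrightarrow> \<bar>u a - u b\<bar> \<le> W * dist a b"
    and outU: "\<And>a b. dist a b < \<epsilon> \<Longrightarrow> a \<notin> U \<Longrightarrow> b \<notin> U \<Longrightarrow> \<bar>u a - u b\<bar> \<le> dist a b"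
  shows "upper_gradient (\<lambda>z. if z \<in> U then ennreal W else 1) u"
  unfolding upper_gradient_def
proof (intro conjI allI impI)
  show "(\<lambda>z. if z \<in> U then ennreal W else 1) \<in> borel_measurable borel"
    using U by (intro measurable_If_set) auto
next
  fix \<gamma> :: "'a set" and x y
  assume "rectifiable_continuum \<gamma> \<and> x \<in> \<gamma> \<and> y \<in> \<gamma>"
  then have \<gamma>: "compact \<gamma>" "connected \<gamma>" and xy: "x \<in> \<gamma>" "y \<in> \<gamma>"
    by (auto simp: rectifiable_continuum_def continuum_def)
  have [measurable]: "\<gamma> \<in> sets borel" "U \<in> sets borel"
    using \<gamma> U by (auto intro: borel_closed compact_imp_closed)
  have "continuous_on \<gamma> u"
  proof (rule continuous_onI)
    fix a and e :: real assume "0 < e"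
    show "\<exists>d>0. \<forall>b\<in>\<gamma>. dist b a < d \<longrightarrow> dist (u b) (u a) \<le> e"
    proof (intro exI[of _ "min \<epsilon> (e/W)"] conjI ballI impI)
      fix b assume "dist b a < min \<epsilon> (e/W)"
      then have "\<bar>u b - u a\<bar> \<le> W * dist b a" "W * dist b a \<le> e"
        using inU[of b a] \<open>0 < W\<close> by (auto simp: field_simps)
      then show "dist (u b) (u a) \<le> e" by (simp add: dist_real_def)
    qed (use \<open>0 < e\<close> assms in auto)
  qed
  then have "ennreal \<bar>u x - u y\<bar> \<le> hausdorff1_content (u ` \<gamma>)"
    using \<gamma> xy by (intro hausdorff1_content_connected_real connected_continuous_image) auto
  also have "u ` \<gamma> = u ` (\<gamma> - U) \<union> u ` (\<gamma> \<inter> U)" by auto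
  also have "hausdorff1_content \<dots> \<le> hausdorff1_content (u ` (\<gamma> - U)) + hausdorff1_content (u ` (\<gamma> \<inter> U))"
    by (rule hausdorff1_content_Un)
  also have "\<dots> \<le> ennreal 1 * hausdorff1_outer (\<gamma> - U) + ennreal W * hausdorff1_outer (\<gamma> \<inter> U)"
    using assms by (intro add_mono hausdorff1_content_image_le_outer[of _ \<epsilon>]) (auto simp: dist_real_def)
  also have "\<dots> = 1 * emeasure hausdorff1 (\<gamma> - U) + ennreal W * emeasure hausdorff1 (\<gamma> \<inter> U)"
    by (simp add: emeasure_hausdorff1)
  also have "\<dots> = (\<integral>\<^sup>+z. 1 * indicator (\<gamma> - U) z + ennreal W * indicator (\<gamma> \<inter> U) z \<partial>hausdorff1)"
    by (subst nn_integral_add) (auto simp: nn_integral_cmult_indicator)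
  also have "\<dots> = (\<integral>\<^sup>+z\<in>\<gamma>. (if z \<in> U then ennreal W else 1) \<partial>hausdorff1)"
    by (intro nn_integral_cong) (auto simp: indicator_def)
  finally show "ennreal \<bar>u x - u y\<bar> \<le> (\<integral>\<^sup>+z\<in>\<gamma>. (if z \<in> U then ennreal W else 1) \<partial>hausdorff1)" .
qed

section \<open>Chains and their weighted cost\<close>

text \<open>The infimum of \<open>\<integral>\<^sub>\<gamma> g d\<H>\<^sup>1\<close> over curves starting in \<open>A\<close> would be the natural test function, but its
measurability is a delicate question.  Chains with steps shorter than \<open>\<epsilon>\<close> replace the curves: the
resulting infimum is continuous for trivial reasons.  A step costs \<open>W\<close> times its length as soon as
one of its endpoints is in \<open>U\<close>, which makes the cost symmetric.\<close>

inductive chain_cost :: "'a::metric_space set \<Rightarrow> 'a set \<Rightarrow> real \<Rightarrow> real \<Rightarrow> 'a \<Rightarrow> real \<Rightarrow> bool"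
  for A U W \<epsilon> where
  start: "y \<in> A \<Longrightarrow> chain_cost A U W \<epsilon> y 0"
| step: "chain_cost A U W \<epsilon> y c \<Longrightarrow> dist y z < \<epsilon> \<Longrightarrow>
    chain_cost A U W \<epsilon> z (c + (if y \<in> U \<or> z \<in> U then W else 1) * dist y z)"

lemma chain_cost_nonneg: "chain_cost A U W \<epsilon> y c \<Longrightarrow> 0 \<le> W \<Longrightarrow> 0 \<le> c"
  by (induction rule: chain_cost.induct) auto

text \<open>Inserting \<open>T\<close> makes the function bounded, and the infimum is over a nonempty set even at points that
no chain reaches.\<close>

definition truncated_cost :: "'a::metric_space set \<Rightarrow> 'a set \<Rightarrow> real \<Rightarrow> real \<Rightarrow> real \<Rightarrow> 'a \<Rightarrow> real" where
  "truncated_cost A U W \<epsilon> T y = Inf (insert T {c. chain_cost A U W \<epsilon> y c})"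

context
  fixes A U :: "'a::metric_space set" and W \<epsilon> T :: real
  assumes W: "1 \<le> W" and T: "0 \<le> T"
begin

lemma truncated_cost_bdd: "bdd_below (insert T {c. chain_cost A U W \<epsilon> y c})"
  using T W chain_cost_nonneg by (intro bdd_belowI[of _ 0]) fastforce

lemma truncated_cost_nonneg: "0 \<le> truncated_cost A U W \<epsilon> T y"
  unfolding truncated_cost_def using T W chain_cost_nonneg by (intro cInf_greatest) fastforce+

lemma truncated_cost_le: "truncated_cost A U W \<epsilon> T y \<le> T"
  unfolding truncated_cost_def by (intro cInf_lower truncated_cost_bdd) auto

lemma truncated_cost_le_chain: "chain_cost A U W \<epsilon> y c \<Longrightarrow> truncated_cost A U W \<epsilon> T y \<le> c"
  unfolding truncated_cost_def by (intro cInf_lower truncated_cost_bdd) auto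

lemma truncated_cost_start: "y \<in> A \<Longrightarrow> truncated_cost A U W \<epsilon> T y = 0"
  using truncated_cost_le_chain[OF chain_cost.start] truncated_cost_nonneg by (simp add: antisym)

text \<open>Appending one step to a chain that ends at \<open>y\<close> gives a chain that ends at \<open>z\<close>, and conversely.\<close>

lemma truncated_cost_step:
  assumes "dist y z < \<epsilon>"
  shows "\<bar>truncated_cost A U W \<epsilon> T y - truncated_cost A U W \<epsilon> T z\<bar>
    \<le> (if y \<in> U \<or> z \<in> U then W else 1) * dist y z"
proof -
  have one: "truncated_cost A U W \<epsilon> T b \<le> truncated_cost A U W \<epsilon> T a + (if a \<in> U \<or> b \<in> U then W else 1) * dist a b"
    if "dist a b < \<epsilon>" for a b
  proof -
    let ?w = "(if a \<in> U \<or> b \<in> U then W else 1) * dist a b"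
    have "truncated_cost A U W \<epsilon> T b - ?w \<le> truncated_cost A U W \<epsilon> T a"
      unfolding truncated_cost_def[of A U W \<epsilon> T a]
    proof (rule cInf_greatest)
      fix c assume "c \<in> insert T {c. chain_cost A U W \<epsilon> a c}"
      then consider "c = T" | "chain_cost A U W \<epsilon> a c" by auto
      then show "truncated_cost A U W \<epsilon> T b - ?w \<le> c"
      proof cases
        case 1
        have "0 \<le> ?w" using W by auto
        then show ?thesis using truncated_cost_le[of b] 1 by linarith
      next
        case 2
        then show ?thesis using truncated_cost_le_chain[OF chain_cost.step[OF 2 that]] by linarith
      qed
    qed auto
    then show ?thesis by linarith
  qed
  have "(if z \<in> U \<or> y \<in> U then W else 1) * dist z y = (if y \<in> U \<or> z \<in> U then W else 1) * dist y z"
    by (auto simp: dist_commute)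
  then show ?thesis using one[OF assms] one[of z y] assms by (auto simp: dist_commute abs_le_iff)
qed

lemma truncated_cost_chain:
  assumes "truncated_cost A U W \<epsilon> T y < T"
  obtains c where "chain_cost A U W \<epsilon> y c" "c < T"
  using cInf_lessD[OF _ assms[unfolded truncated_cost_def]] by auto

lemma truncated_cost_upper_gradient:
  assumes "0 < \<epsilon>" "U \<in> sets borel"
  shows "upper_gradient (\<lambda>z. if z \<in> U then ennreal W else 1) (truncated_cost A U W \<epsilon> T)"
proof (rule upper_gradient_two_valued[of \<epsilon>])
  fix a b :: 'a assume ab: "dist a b < \<epsilon>"
  have "(if a \<in> U \<or> b \<in> U then W else 1) * dist a b \<le> W * dist a b"
    using W by (intro mult_right_mono) auto
  with truncated_cost_step[OF ab]
  show "\<bar>truncated_cost A U W \<epsilon> T a - truncated_cost A U W \<epsilon> T b\<bar> \<le> W * dist a b" by linarith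
  assume "a \<notin> U" "b \<notin> U"
  with truncated_cost_step[OF ab]
  show "\<bar>truncated_cost A U W \<epsilon> T a - truncated_cost A U W \<epsilon> T b\<bar> \<le> dist a b" by simp
qed (use assms W in auto)

lemma truncated_cost_continuous:
  assumes "0 < \<epsilon>"
  shows "continuous_on UNIV (truncated_cost A U W \<epsilon> T)"
proof (rule continuous_onI)
  fix a :: 'a and e :: real assume "0 < e"
  show "\<exists>d>0. \<forall>b\<in>UNIV. dist b a < d \<longrightarrow>
    dist (truncated_cost A U W \<epsilon> T b) (truncated_cost A U W \<epsilon> T a) \<le> e"
  proof (intro exI[of _ "min \<epsilon> (e/W)"] conjI ballI impI)
    fix b assume d: "dist b a < min \<epsilon> (e/W)"
    have "(if b \<in> U \<or> a \<in> U then W else 1) * dist b a \<le> W * dist b a"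
      using W by (intro mult_right_mono) auto
    also have "\<dots> \<le> e" using d W by (simp add: field_simps)
    finally show "dist (truncated_cost A U W \<epsilon> T b) (truncated_cost A U W \<epsilon> T a) \<le> e"
      using truncated_cost_step[of b a] d by (simp add: dist_real_def)
  qed (use \<open>0 < e\<close> assms W in auto)
qed

end

section \<open>From chains to curves\<close>

text \<open>A chain is turned into a step function \<open>f\<close> by letting the time be the cost spent so far.
The auxiliary \<open>b t\<close> is the cost at the last vertex reached by time \<open>t\<close>; until the chain ends it lags
behind \<open>t\<close> by at most the cost \<open>W * \<epsilon>\<close> of one step.  Measuring displacement against \<open>b\<close> instead of \<open>t\<close> lets the
estimates add up along the chain without accumulating errors.  In this parametrization \<open>f\<close> has speed
at most \<open>1\<close>, and at most \<open>1 / W\<close> as long as it stays in \<open>U\<close>.\<close>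

lemma chain_cost_time_curve:
  assumes "chain_cost A U W \<epsilon> y c" and W: "1 \<le> W" and \<epsilon>: "0 < \<epsilon>"
  shows "\<exists>f b. f 0 \<in> A \<and> 0 \<le> c \<and> (\<forall>t\<ge>c. f t = y \<and> b t = c) \<and>
     (\<forall>t. min t c - W * \<epsilon> \<le> b t \<and> b t \<le> max 0 t \<and> 0 \<le> b t) \<and>
     (\<forall>s t. s \<le> t \<longrightarrow> dist (f s) (f t) \<le> b t - b s \<and>
        ((\<forall>q\<in>{s..t}. f q \<in> U) \<longrightarrow> W * dist (f s) (f t) \<le> b t - b s))"
  using assms(1)
proof (induction rule: chain_cost.induct)
  case (start y)
  have "0 \<le> W * \<epsilon>" using W \<epsilon> by simp
  then show ?case using start by (intro exI[of _ "\<lambda>_. y"] exI[of _ "\<lambda>_. 0::real"]) auto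
next
  case (step y c z)
  obtain f b where f0: "f 0 \<in> A" and c0: "0 \<le> c" and fin: "\<And>t. c \<le> t \<Longrightarrow> f t = y \<and> b t = c"
    and b: "\<And>t. min t c - W * \<epsilon> \<le> b t" "\<And>t. b t \<le> max 0 t" "\<And>t. 0 \<le> b t"
    and d: "\<And>s t. s \<le> t \<Longrightarrow> dist (f s) (f t) \<le> b t - b s"
    and dU: "\<And>s t. s \<le> t \<Longrightarrow> (\<forall>q\<in>{s..t}. f q \<in> U) \<Longrightarrow> W * dist (f s) (f t) \<le> b t - b s"
    using step.IH by blast
  define w where "w = (if y \<in> U \<or> z \<in> U then W else 1)"
  have w: "1 \<le> w" "w \<le> W" using W by (auto simp: w_def)
  define c' where "c' = c + w * dist y z"
  have "dist y z \<le> w * dist y z" using w mult_right_mono[of 1 w "dist y z"] by simp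
  then have c': "c \<le> c'" "dist y z \<le> c' - c" using zero_le_dist[of y z] unfolding c'_def by linarith+
  have "w * dist y z \<le> W * \<epsilon>" using w W step.hyps by (intro mult_mono) auto
  then have c'\<epsilon>: "c' - W * \<epsilon> \<le> c" by (simp add: c'_def)
  \<comment> \<open>the last vertex \<open>z\<close> is entered at time \<open>c'\<close>, when the step from \<open>y\<close> has been paid for\<close>
  define f' where "f' t = (if t < c' then f t else z)" for t
  define b' where "b' t = (if t < c' then b t else c')" for t
  have zy: "z = y" if "c' = c" using that w by (auto simp: c'_def)
  have dfy: "dist (f s) y \<le> c - b s" for s
    using d[of s "max s c"] fin[of "max s c"] by auto
  have dz: "dist (f s) z \<le> c' - b s" for s
    using dfy[of s] dist_triangle[of "f s" z y] c'(2) by linarith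
  have dzU: "W * dist (f s) z \<le> c' - b s"
    if s: "s < c'" and z: "z \<in> U" and U: "\<forall>q\<in>{s..<c'}. f q \<in> U" for s
  proof -
    have "W * dist (f s) y \<le> c - b s"
    proof (cases "s \<le> c")
      case True
      have "f q \<in> U" if "q \<in> {s..c}" for q
      proof (cases "q < c'")
        case False
        then have "q = c" "c' = c" using that c'(1) by auto
        then show ?thesis using fin[of c] zy z by simp
      qed (use that U in auto)
      then show ?thesis using dU[OF True] fin[of c] by simp
    qed (use fin[of s] in auto)
    moreover have "W * dist y z = c' - c" using z by (simp add: c'_def w_def)
    moreover have "W * dist (f s) z \<le> W * dist (f s) y + W * dist y z"
      using W dist_triangle[of "f s" z y] by (simp add: distrib_left[symmetric])
    ultimately show ?thesis by linarith
  qed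
  have c'0: "0 \<le> c'" using c0 c' by simp
  have fb: "min t c' - W * \<epsilon> \<le> b' t \<and> b' t \<le> max 0 t \<and> 0 \<le> b' t" for t
  proof (cases "t < c'")
    case True
    have "min t c' - W * \<epsilon> \<le> b t"
      using b(1)[of t] fin[of t] True c'\<epsilon> by (cases "t \<le> c") auto
    then show ?thesis using True b by (auto simp: b'_def)
  next
    case False
    have "0 \<le> W * \<epsilon>" using W \<epsilon> by simp
    with False c'0 show ?thesis by (auto simp: b'_def)
  qed
  have dd: "dist (f' s) (f' t) \<le> b' t - b' s \<and>
      ((\<forall>q\<in>{s..t}. f' q \<in> U) \<longrightarrow> W * dist (f' s) (f' t) \<le> b' t - b' s)" if st: "s \<le> t" for s t
  proof -
    consider "t < c'" | "s < c'" "c' \<le> t" | "c' \<le> s" by linarith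
    then show ?thesis
    proof cases
      case 1
      then have "(\<forall>q\<in>{s..t}. f' q \<in> U) \<longleftrightarrow> (\<forall>q\<in>{s..t}. f q \<in> U)" by (auto simp: f'_def)
      then show ?thesis using 1 st d[OF st] dU[OF st] by (simp add: f'_def b'_def)
    next
      case 2
      have "z \<in> U \<and> (\<forall>q\<in>{s..<c'}. f q \<in> U)" if U: "\<forall>q\<in>{s..t}. f' q \<in> U"
      proof
        show "z \<in> U" using U[rule_format, of t] 2 st by (simp add: f'_def)
        show "\<forall>q\<in>{s..<c'}. f q \<in> U"
        proof
          fix q assume "q \<in> {s..<c'}"
          then show "f q \<in> U" using U[rule_format, of q] 2 by (simp add: f'_def)
        qed
      qed
      moreover have "f' s = f s" "f' t = z" "b' s = b s" "b' t = c'" using 2 by (simp_all add: f'_def b'_def)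
      ultimately show ?thesis using dz[of s] dzU[OF 2(1)] by metis
    next
      case 3
      then show ?thesis using st by (simp add: f'_def b'_def)
    qed
  qed
  have f'0: "f' 0 \<in> A"
    using f0 fin[of 0] c0 c'(1) zy by (cases "0 < c'") (auto simp: f'_def)
  show ?case
    unfolding w_def[symmetric] c'_def[symmetric]
  proof (intro exI[of _ f'] exI[of _ b'] conjI)
    show "\<forall>t\<ge>c'. f' t = z \<and> b' t = c'" by (simp add: f'_def b'_def)
    show "\<forall>t. min t c' - W * \<epsilon> \<le> b' t \<and> b' t \<le> max 0 t \<and> 0 \<le> b' t" using fb by blast
    show "\<forall>s t. s \<le> t \<longrightarrow> dist (f' s) (f' t) \<le> b' t - b' s \<and>
        ((\<forall>q\<in>{s..t}. f' q \<in> U) \<longrightarrow> W * dist (f' s) (f' t) \<le> b' t - b' s)" using dd by blast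
  qed (fact f'0 c'0)+
qed

text \<open>By Tychonoff the sequence \<open>F\<close> has a cluster point in the product \<open>C\<^sup>I\<close>.  This replaces the
Arzela-Ascoli theorem for functions that are only approximately continuous; the index \<open>n\<close> depends on the
finitely many coordinates \<open>J\<close>, which suffices for inequalities that involve finitely many values.\<close>

lemma pointwise_cluster_function:
  fixes F :: "nat \<Rightarrow> 'i \<Rightarrow> 'a::metric_space"
  assumes "compact C" and "\<And>n i. F n i \<in> C"
  shows "\<exists>f. \<forall>J e N. finite J \<longrightarrow> 0 < e \<longrightarrow> (\<exists>n\<ge>N. \<forall>i\<in>J. dist (F n i) (f i) < e)"
proof -
  have "compactin (product_topology (\<lambda>_. euclidean) UNIV) (PiE UNIV (\<lambda>_::'i. C))"
    using assms(1) by (simp add: compactin_PiE)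
  then have "compact (PiE UNIV (\<lambda>_::'i. C))" by (simp add: euclidean_product_topology)
  moreover have "filtermap F sequentially \<noteq> bot" by (simp add: filtermap_bot_iff)
  moreover have "eventually (\<lambda>g. g \<in> PiE UNIV (\<lambda>_. C)) (filtermap F sequentially)"
    using assms(2) by (simp add: eventually_filtermap PiE_UNIV_domain)
  ultimately obtain f where f: "f \<in> PiE UNIV (\<lambda>_. C)" "inf (nhds f) (filtermap F sequentially) \<noteq> bot"
    unfolding compact_filter by blast
  have "\<exists>n\<ge>N. \<forall>i\<in>J. dist (F n i) (f i) < e" if J: "finite J" and e: "0 < e" for J e N
  proof (rule ccontr)
    assume no: "\<not> ?thesis"
    have "open {g. \<forall>i\<in>J. g (id i) \<in> ball (f i) e}"
      by (rule product_topology_basis'[OF J]) auto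
    then have "eventually (\<lambda>g. \<forall>i\<in>J. g i \<in> ball (f i) e) (nhds f)"
      unfolding eventually_nhds using e by (intro exI[of _ "{g. \<forall>i\<in>J. g (id i) \<in> ball (f i) e}"]) auto
    moreover have "eventually (\<lambda>g. \<not> (\<forall>i\<in>J. g i \<in> ball (f i) e)) (filtermap F sequentially)"
      unfolding eventually_filtermap eventually_sequentially
      using no by (intro exI[of _ N]) (auto simp: dist_commute)
    ultimately have "eventually (\<lambda>_. False) (inf (nhds f) (filtermap F sequentially))"
      unfolding eventually_inf by blast
    then show False using f(2) by (simp add: eventually_False)
  qed
  then show ?thesis by blast
qed

text \<open>The errors \<open>e n\<close> disappear in the limit.  The bound for the speed in \<open>U\<close> survives because \<open>U\<close> is open:
near a time at which \<open>f\<close> is in \<open>U\<close>, late members of the sequence stay in a ball contained in \<open>U\<close> for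
the whole time interval.\<close>

lemma coarse_curves_limit:
  fixes F :: "nat \<Rightarrow> real \<Rightarrow> 'a::metric_space" and U :: "'a set"
  assumes C: "compact C" "\<And>n t. F n t \<in> C" and U: "open U"
    and e: "e \<longlonglongrightarrow> 0"
    and lip: "\<And>n s t. s \<le> t \<Longrightarrow> dist (F n s) (F n t) \<le> t - s + e n"
    and lipU: "\<And>n s t. s \<le> t \<Longrightarrow> (\<forall>q\<in>{s..t}. F n q \<in> U) \<Longrightarrow> W * dist (F n s) (F n t) \<le> t - s + e n"
    and W: "0 < W"
  obtains f where "\<And>s t. s \<le> t \<Longrightarrow> dist (f s) (f t) \<le> t - s"
    and "\<And>t. f t \<in> U \<Longrightarrow> \<exists>\<delta>>0. \<forall>s s'. t - \<delta> < s \<and> s \<le> s' \<and> s' < t + \<delta> \<longrightarrow> W * dist (f s) (f s') \<le> s' - s"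
    and "\<And>t D. closed D \<Longrightarrow> (\<And>n. F n t \<in> D) \<Longrightarrow> f t \<in> D"
proof -
  obtain f where cl: "\<forall>J e N. finite J \<longrightarrow> 0 < e \<longrightarrow> (\<exists>n\<ge>N. \<forall>i\<in>J. dist (F n i) (f i) < e)"
    using pointwise_cluster_function[of C F, OF C] by (rule exE)
  have approx: "\<exists>n. e n < \<eta> \<and> dist (F n s) (f s) < \<eta> \<and> dist (F n t) (f t) < \<eta>"
    if \<eta>: "0 < \<eta>" for \<eta> s t
  proof -
    obtain N where "\<forall>n\<ge>N. e n < \<eta>"
      using order_tendstoD(2)[OF e \<eta>] by (auto simp: eventually_sequentially)
    moreover obtain n where "n \<ge> N" "\<forall>i\<in>{s,t}. dist (F n i) (f i) < \<eta>"
      using cl[rule_format, of "{s,t}" \<eta> N] \<eta> by auto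
    ultimately show ?thesis by auto
  qed
  have tri: "dist (f s) (f t) \<le> dist (F n s) (F n t) + dist (F n s) (f s) + dist (F n t) (f t)" for n s t
    using dist_triangle[of "f s" "f t" "F n s"] dist_triangle[of "F n s" "f t" "F n t"]
    by (simp add: dist_commute)
  have 1: "dist (f s) (f t) \<le> t - s" if "s \<le> t" for s t
  proof (rule field_le_epsilon)
    fix \<eta> :: real assume "0 < \<eta>"
    then obtain n where "e n < \<eta>/3" "dist (F n s) (f s) < \<eta>/3" "dist (F n t) (f t) < \<eta>/3"
      using approx[of "\<eta>/3" s t] by auto
    then show "dist (f s) (f t) \<le> t - s + \<eta>" using tri[of s t n] lip[OF that, of n] by linarith
  qed
  have 2: "\<exists>\<delta>>0. \<forall>s s'. t - \<delta> < s \<and> s \<le> s' \<and> s' < t + \<delta> \<longrightarrow> W * dist (f s) (f s') \<le> s' - s" if ft: "f t \<in> U" for t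
  proof -
    obtain r where r: "0 < r" "ball (f t) r \<subseteq> U" using U ft openE by blast
    \<comment> \<open>the fifth of \<open>r\<close> leaves room for: time elapsed (two), displacement of \<open>f\<close> (one), error terms (two)\<close>
    define \<delta> where "\<delta> = r / 5"
    have \<delta>: "0 < \<delta>" "r = 5 * \<delta>" using r by (auto simp: \<delta>_def)
    show ?thesis
    proof (intro exI[of _ \<delta>] conjI allI impI)
      fix s s' assume ss: "t - \<delta> < s \<and> s \<le> s' \<and> s' < t + \<delta>"
      show "W * dist (f s) (f s') \<le> s' - s"
      proof (rule field_le_epsilon)
        fix \<eta> :: real assume \<eta>: "0 < \<eta>"
        \<comment> \<open>\<open>1 + 2 * W\<close> collects \<open>e n\<close> and the two approximation errors at \<open>s\<close> and \<open>s'\<close>, scaled by \<open>W\<close>\<close>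
        define \<zeta> where "\<zeta> = min \<delta> (\<eta> / (1 + 2 * W))"
        have "0 < 1 + 2 * W" using W by simp
        then have "\<zeta> * (1 + 2 * W) \<le> \<eta>"
          by (subst pos_le_divide_eq[symmetric]) (simp_all add: \<zeta>_def)
        then have \<zeta>: "0 < \<zeta>" "\<zeta> \<le> \<delta>" "(1 + 2 * W) * \<zeta> \<le> \<eta>"
          using \<eta> W \<delta> by (auto simp: \<zeta>_def mult.commute)
        obtain n where n: "e n < \<zeta>" "dist (F n s) (f s) < \<zeta>" "dist (F n s') (f s') < \<zeta>"
          using approx[OF \<zeta>(1), of s s'] by auto
        have "F n q \<in> U" if q: "q \<in> {s..s'}" for q
        proof -
          have "dist (F n s) (F n q) \<le> q - s + e n" using q by (intro lip) auto
          moreover have "dist (f s) (f t) \<le> \<delta>"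
            using 1[of s t] 1[of t s] ss by (cases "s \<le> t") (auto simp: dist_commute)
          moreover have "dist (f t) (F n q) \<le> dist (f s) (f t) + dist (F n s) (f s) + dist (F n s) (F n q)"
            using dist_triangle[of "f t" "F n q" "f s"] dist_triangle[of "f s" "F n q" "F n s"]
            by (simp add: dist_commute)
          ultimately have "dist (f t) (F n q) < r" using n \<zeta> \<delta> ss q by auto
          then show ?thesis using r by auto
        qed
        then have "W * dist (F n s) (F n s') \<le> s' - s + e n" using ss by (intro lipU) auto
        moreover have "W * dist (f s) (f s') \<le> W * (dist (F n s) (F n s') + \<zeta> + \<zeta>)"
          using tri[of s s' n] n W by (intro mult_left_mono) auto
        ultimately show "W * dist (f s) (f s') \<le> s' - s + \<eta>" using \<zeta>(3) n(1) by (simp add: algebra_simps)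
      qed
    qed (use \<delta> in auto)
  qed
  have 3: "f t \<in> D" if "closed D" "\<And>n. F n t \<in> D" for t D
  proof -
    have "\<exists>y\<in>D. dist y (f t) < \<eta>" if "0 < \<eta>" for \<eta>
      using approx[OF that, of t t] \<open>\<And>n. F n t \<in> D\<close> by blast
    then show ?thesis using \<open>closed D\<close> closed_approachable by blast
  qed
  show thesis using 1 2 3 by (rule that[of f])
qed

section \<open>Hausdorff measure of Lipschitz curves\<close>

lemma uniform_partition_covers:
  fixes a b :: real
  assumes "t \<in> {a..b}" "0 < n"
  obtains i where "i < n" "t \<in> {a + real i * ((b - a)/real n)..a + real (Suc i) * ((b - a)/real n)}"
proof (cases "t = b")
  case True
  have "real n * ((b - a)/real n) = b - a" using assms by simp
  moreover have "0 \<le> (b - a)/real n" using assms by simp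
  moreover have "real (n - 1) * ((b - a)/real n) \<le> real n * ((b - a)/real n)"
    using calculation by (intro mult_right_mono) auto
  ultimately show thesis
    using True assms by (intro that[of "n - 1"]) (auto simp: Suc_diff_Suc)
next
  case False
  define h where "h = (b - a)/real n"
  have h: "0 < h" "real n * h = b - a" using assms False by (auto simp: h_def)
  define i where "i = nat \<lfloor>(t - a)/h\<rfloor>"
  have "real i \<le> (t - a)/h" "(t - a)/h < real i + 1" using h assms by (auto simp: i_def)
  then have i: "real i * h \<le> t - a" "t - a < (real i + 1) * h" using h by (auto simp: field_simps)
  then have "real i * h < real n * h" using h assms False by auto
  then have "i < n" using h(1) mult_less_cancel_right_pos[of h "real i" "real n"] by simp
  then show thesis using i by (intro that[of i]) (auto simp: h_def algebra_simps)
qed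

lemma hausdorff1_outer_lipschitz_curve:
  fixes f :: "real \<Rightarrow> 'a::metric_space"
  assumes ab: "a \<le> b" and L: "0 \<le> L"
    and lip: "\<And>s t. s \<in> {a..b} \<Longrightarrow> t \<in> {a..b} \<Longrightarrow> dist (f s) (f t) \<le> L * dist s t"
  shows "hausdorff1_outer (f ` {a..b}) \<le> ennreal (L * (b - a))"
  unfolding hausdorff1_outer_def
proof (rule SUP_least)
  fix \<delta> :: real assume "\<delta> \<in> {0<..}"
  then have \<delta>: "0 < \<delta>" by simp
  obtain n :: nat where n: "L * (b - a) / \<delta> < real n" using reals_Archimedean2 by blast
  have "0 \<le> L * (b - a) / \<delta>" using ab L \<delta> by simp
  then have n0: "0 < n" using n by (cases n) auto
  define h where "h = (b - a)/real n"
  have h: "0 \<le> h" "real n * h = b - a" using ab n0 by (auto simp: h_def)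
  have Lh: "L * h \<le> \<delta>" using n n0 \<delta> by (simp add: h_def field_simps)
  define A where "A i = (if i < n then f ` {a + real i * h..a + real (Suc i) * h} else {})" for i
  have diam: "ediam (A i) \<le> (if i < n then ennreal (L * h) else 0)" for i
  proof (cases "i < n")
    case True
    have "real (Suc i) * h \<le> real n * h" using True h by (intro mult_right_mono) auto
    then have sub: "{a + real i * h..a + real (Suc i) * h} \<subseteq> {a..b}" using h by auto
    have "ediam (A i) \<le> ennreal L * ediam {a + real i * h..a + real (Suc i) * h}"
      using True L sub by (auto simp only: A_def if_True intro!: ediam_image_le lip)
    also have "ediam {a + real i * h..a + real (Suc i) * h} \<le> ennreal h"
      unfolding ediam_def by (intro SUP_least ennreal_leI) (auto simp: dist_real_def algebra_simps)
    finally show ?thesis using True L h by (simp add: ennreal_mult mult_left_mono)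
  qed (simp add: A_def)
  have "hausdorff1_pre \<delta> (f ` {a..b}) \<le> (\<Sum>i. ediam (A i))"
  proof (rule hausdorff1_pre_le)
    show "f ` {a..b} \<subseteq> (\<Union>i. A i)"
    proof
      fix x assume "x \<in> f ` {a..b}"
      then obtain t where t: "t \<in> {a..b}" "x = f t" by auto
      obtain i where "i < n" "t \<in> {a + real i * h..a + real (Suc i) * h}"
        using uniform_partition_covers[OF t(1) n0] unfolding h_def by blast
      then have "x \<in> A i" using t(2) unfolding A_def by auto
      then show "x \<in> (\<Union>i. A i)" by blast
    qed
    show "ediam (A i) \<le> ennreal \<delta>" for i
      by (rule order_trans[OF diam]) (use Lh in \<open>auto intro: ennreal_leI\<close>)
  qed
  also have "\<dots> \<le> (\<Sum>i. if i < n then ennreal (L * h) else 0)" by (intro suminf_le diam) auto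
  also have "\<dots> = (\<Sum>i<n. ennreal (L * h))"
    by (subst suminf_finite[of "{..<n}"]) auto
  also have "\<dots> = ennreal (L * (b - a))"
    unfolding h(2)[symmetric] using h(1) L
    by (simp add: ennreal_of_nat_eq_real_of_nat ennreal_mult[symmetric] mult.left_commute)
  finally show "hausdorff1_pre \<delta> (f ` {a..b}) \<le> ennreal (L * (b - a))" .
qed

text \<open>Cut \<open>{0..T}\<close> into \<open>n + 1\<close> equal intervals and let \<open>P n\<close> be the union of the images of those on which \<open>f\<close> is
\<open>L\<close>-Lipschitz; their total length is at most \<open>T\<close>, so \<open>P n\<close> has measure at most \<open>L * T\<close>.  Every point
of \<open>f ` V\<close> belongs to \<open>P n\<close> for all large \<open>n\<close>, that is, to the lower limit of these sets, which has
measure at most \<open>L * T\<close> by continuity from below.\<close>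

lemma hausdorff1_locally_lipschitz_part:
  fixes f :: "real \<Rightarrow> 'a::metric_space"
  assumes T: "0 \<le> T" and L: "0 \<le> L" and cont: "continuous_on {0..T} f"
    and V: "V \<subseteq> {0..T}"
    and loc: "\<And>t. t \<in> V \<Longrightarrow> \<exists>\<delta>>0. \<forall>s s'. t - \<delta> < s \<and> s \<le> s' \<and> s' < t + \<delta> \<longrightarrow> dist (f s) (f s') \<le> L * (s' - s)"
  shows "hausdorff1_outer (f ` V) \<le> ennreal (L * T)"
proof -
  define h where "h n = T / real (Suc n)" for n
  define I where "I n i = {real i * h n..real (Suc i) * h n}" for n i
  define G where "G n = {i. i < Suc n \<and> (\<forall>s\<in>I n i. \<forall>s'\<in>I n i. dist (f s) (f s') \<le> L * dist s s')}" for n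
  define P where "P n = (\<Union>i\<in>G n. f ` I n i)" for n
  have h: "0 \<le> h n" "real (Suc n) * h n = T" for n using T by (auto simp: h_def)
  have [simp]: "finite (G n)" "card (G n) \<le> Suc n" for n
  proof -
    have "G n \<subseteq> {..<Suc n}" by (auto simp: G_def)
    then show "finite (G n)" "card (G n) \<le> Suc n"
      using finite_subset card_mono[of "{..<Suc n}" "G n"] by auto
  qed
  have I_sub: "I n i \<subseteq> {0..T}" if "i \<in> G n" for n i
  proof -
    have "real (Suc i) * h n \<le> real (Suc n) * h n" using that h by (intro mult_right_mono) (auto simp: G_def)
    then show ?thesis using h[of n] by (auto simp: I_def)
  qed
  have meas: "f ` I n i \<in> sets borel" if "i \<in> G n" for n i
  proof -
    have "compact (f ` I n i)"
      using cont I_sub[OF that] by (intro compact_continuous_image) (auto simp: I_def intro: continuous_on_subset)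
    then show ?thesis by (simp add: borel_closed compact_imp_closed)
  qed
  have measP: "P n \<in> sets borel" for n unfolding P_def by (intro sets.finite_UN meas) auto
  have P_le: "emeasure hausdorff1 (P n) \<le> ennreal (L * T)" for n
  proof -
    have "emeasure hausdorff1 (P n) \<le> (\<Sum>i\<in>G n. emeasure hausdorff1 (f ` I n i))"
      unfolding P_def using meas by (intro emeasure_subadditive_finite) auto
    also have "\<dots> \<le> (\<Sum>i\<in>G n. ennreal (L * h n))"
    proof (rule sum_mono)
      fix i assume i: "i \<in> G n"
      have "hausdorff1_outer (f ` I n i) \<le> ennreal (L * (real (Suc i) * h n - real i * h n))"
        unfolding I_def using i h L
        by (intro hausdorff1_outer_lipschitz_curve) (auto simp: G_def I_def algebra_simps)
      then show "emeasure hausdorff1 (f ` I n i) \<le> ennreal (L * h n)"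
        using meas[OF i] by (simp add: emeasure_hausdorff1 algebra_simps)
    qed
    also have "\<dots> = ennreal (real (card (G n)) * (L * h n))"
      using L h by (simp add: ennreal_of_nat_eq_real_of_nat ennreal_mult)
    also have "\<dots> \<le> ennreal (real (Suc n) * (L * h n))"
      using L h by (intro ennreal_leI mult_right_mono of_nat_mono) (auto simp del: of_nat_Suc)
    also have "real (Suc n) * (L * h n) = L * T" using h(2)[of n] by (metis mult.left_commute)
    finally show ?thesis .
  qed
  define Q where "Q n = (\<Inter>m. P (n + m))" for n
  have measQ: "Q n \<in> sets borel" for n unfolding Q_def using measP by (intro sets.countable_INT) auto
  have "Q n \<subseteq> Q (n + d)" for n d
    unfolding Q_def by (auto simp: add.assoc)
  then have "incseq Q" unfolding incseq_def by (metis le_Suc_ex)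
  have "f ` V \<subseteq> (\<Union>n. Q n)"
  proof
    fix x assume "x \<in> f ` V"
    then obtain t where t: "t \<in> V" "x = f t" by auto
    obtain \<delta> where \<delta>: "0 < \<delta>" "\<And>s s'. t - \<delta> < s \<Longrightarrow> s \<le> s' \<Longrightarrow> s' < t + \<delta> \<Longrightarrow> dist (f s) (f s') \<le> L * (s' - s)"
      using loc[OF t(1)] by blast
    obtain N :: nat where N: "T / \<delta> < real N" using reals_Archimedean2 by blast
    have "x \<in> P m" if "N \<le> m" for m
    proof -
      have "T / \<delta> < real (Suc m)" using N that by simp
      then have hm: "h m < \<delta>" using \<delta> by (simp add: h_def field_simps)
      obtain i where i: "i < Suc m" "t \<in> I m i"
        using uniform_partition_covers[of t 0 T "Suc m"] t V unfolding I_def h_def diff_zero add_0_left by blast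
      have near: "t - \<delta> < s" "s < t + \<delta>" if "s \<in> I m i" for s
        using that i(2) hm by (auto simp: I_def algebra_simps)
      have "dist (f s) (f s') \<le> L * dist s s'" if "s \<in> I m i" "s' \<in> I m i" for s s'
        using \<delta>(2)[of s s'] \<delta>(2)[of s' s] near that
        by (cases "s \<le> s'") (auto simp: dist_real_def dist_commute)
      then have "i \<in> G m" using i by (auto simp: G_def)
      then show ?thesis using i t by (auto simp: P_def)
    qed
    then have "x \<in> Q N" by (auto simp: Q_def)
    then show "x \<in> (\<Union>n. Q n)" by blast
  qed
  then have "hausdorff1_outer (f ` V) \<le> hausdorff1_outer (\<Union>n. Q n)" by (rule hausdorff1_outer_mono)
  also have "\<dots> = emeasure hausdorff1 (\<Union>n. Q n)" using measQ by (simp add: emeasure_hausdorff1)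
  also have "\<dots> = (SUP n. emeasure hausdorff1 (Q n))"
    using measQ \<open>incseq Q\<close> by (intro SUP_emeasure_incseq[symmetric]) auto
  also have "\<dots> \<le> ennreal (L * T)"
  proof (rule SUP_least)
    fix n
    have "Q n \<subseteq> P n" unfolding Q_def using INT_lower[of 0 UNIV "\<lambda>m. P (n + m)"] by simp
    then have "emeasure hausdorff1 (Q n) \<le> emeasure hausdorff1 (P n)"
      using measP by (intro emeasure_mono) auto
    then show "emeasure hausdorff1 (Q n) \<le> ennreal (L * T)" using P_le order_trans by blast
  qed
  finally show ?thesis .
qed

text \<open>The passage from chains to continua.  Chains of cost less than \<open>T\<close> with steps tending to \<open>0\<close> are run
through in time \<open>T\<close>; the limit curve has speed at most \<open>1\<close>, and at most \<open>1 / W\<close> in \<open>U\<close>, hence the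
two bounds for the Hausdorff measure.\<close>

lemma short_chains_limit_curve:
  fixes A A' U :: "'a::metric_space set"
  assumes proper: "\<And>(x::'a) r. compact (cball x r)" and U: "open U"
    and W: "1 \<le> W" and T: "0 \<le> T" and A: "A \<subseteq> cball x R"
    and chains: "\<forall>\<epsilon>>0. \<exists>y\<in>A'. \<exists>c<T. chain_cost A U W \<epsilon> y c"
  shows "\<exists>\<gamma> p q. continuum \<gamma> \<and> p \<in> \<gamma> \<and> q \<in> \<gamma> \<and> p \<in> closure A \<and> q \<in> closure A' \<and> \<gamma> \<subseteq> cball p T \<and>
     hausdorff1_outer \<gamma> \<le> ennreal T \<and> hausdorff1_outer (\<gamma> \<inter> U) \<le> ennreal (T / W)"
proof -
  define e where "e n = 1 / real (Suc n)" for n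
  have e_pos: "0 < e n" for n by (simp add: e_def)
  have "\<exists>f. f 0 \<in> A \<and> f T \<in> A' \<and> (\<forall>t. f t \<in> cball x (R + T)) \<and>
      (\<forall>s t. s \<le> t \<longrightarrow> dist (f s) (f t) \<le> t - s + e n \<and>
        ((\<forall>q\<in>{s..t}. f q \<in> U) \<longrightarrow> W * dist (f s) (f t) \<le> t - s + e n))" for n
  proof -
    have \<epsilon>: "0 < e n / W" using W e_pos by simp
    obtain y c where y: "y \<in> A'" and c: "c < T" and ch: "chain_cost A U W (e n / W) y c"
      using chains \<epsilon> by blast
    obtain f b where f0: "f 0 \<in> A" and fin: "\<And>t. c \<le> t \<Longrightarrow> f t = y \<and> b t = c"
      and b: "\<And>t. min t c - W * (e n / W) \<le> b t" "\<And>t. b t \<le> max 0 t" "\<And>t. 0 \<le> b t"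
      and d: "\<And>s t. s \<le> t \<Longrightarrow> dist (f s) (f t) \<le> b t - b s"
      and dU: "\<And>s t. s \<le> t \<Longrightarrow> (\<forall>q\<in>{s..t}. f q \<in> U) \<Longrightarrow> W * dist (f s) (f t) \<le> b t - b s"
      using chain_cost_time_curve[OF ch W \<epsilon>] by blast
    have b1: "min t c - e n \<le> b t" for t using b(1)[of t] W by simp
    have bc: "b t \<le> c" for t
      using d[of t "max t c"] fin[of "max t c"] zero_le_dist[of "f t" "f (max t c)"] by linarith
    \<comment> \<open>for \<open>s > c\<close> the curve rests at its endpoint\<close>
    have bb: "b t - b s \<le> t - s + e n" if "s \<le> t" for s t
    proof (cases "s \<le> c")
      case True
      then show ?thesis
        using b1[of s] b(2)[of t] b(3)[of s] that e_pos[of n] by (cases "0 \<le> t") auto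
    next
      case False
      then show ?thesis using bc[of t] fin[of s] that e_pos[of n] by simp
    qed
    have "dist (f 0) (f t) \<le> T" for t
    proof (cases "0 \<le> t")
      case True
      then show ?thesis using d[of 0 t] bc[of t] b(3)[of 0] c by linarith
    next
      case False
      then show ?thesis using d[of t 0] b(2)[of 0] b(3)[of t] T by (simp add: dist_commute)
    qed
    moreover have "dist x (f 0) \<le> R" using f0 A by auto
    ultimately have "dist x (f t) \<le> R + T" for t
      using dist_triangle[of x "f t" "f 0"] by (meson add_mono order_trans)
    moreover have "f T = y" using fin c by simp
    moreover have "dist (f s) (f t) \<le> t - s + e n" if "s \<le> t" for s t
      using d[OF that] bb[OF that] by linarith
    moreover have "W * dist (f s) (f t) \<le> t - s + e n"
      if "s \<le> t" "\<forall>q\<in>{s..t}. f q \<in> U" for s t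
      using dU[OF that] bb[OF that(1)] by linarith
    ultimately show ?thesis
      using f0 y by (intro exI[of _ f]) simp
  qed
  then obtain F where F: "\<And>n. F n 0 \<in> A" "\<And>n. F n T \<in> A'" "\<And>n t. F n t \<in> cball x (R + T)"
    "\<And>n s t. s \<le> t \<Longrightarrow> dist (F n s) (F n t) \<le> t - s + e n"
    "\<And>n s t. s \<le> t \<Longrightarrow> (\<forall>q\<in>{s..t}. F n q \<in> U) \<Longrightarrow> W * dist (F n s) (F n t) \<le> t - s + e n"
    by metis
  have e0: "e \<longlonglongrightarrow> 0"
    unfolding e_def using LIMSEQ_inverse_real_of_nat by (simp add: inverse_eq_divide)
  have W0: "0 < W" using W by simp
  obtain f where lip: "\<And>s t. s \<le> t \<Longrightarrow> dist (f s) (f t) \<le> t - s"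
    and lipU: "\<And>t. f t \<in> U \<Longrightarrow>
      \<exists>\<delta>>0. \<forall>s s'. t - \<delta> < s \<and> s \<le> s' \<and> s' < t + \<delta> \<longrightarrow> W * dist (f s) (f s') \<le> s' - s"
    and lim: "\<And>t D. closed D \<Longrightarrow> (\<And>n. F n t \<in> D) \<Longrightarrow> f t \<in> D"
    using coarse_curves_limit[OF proper F(3) U e0 F(4) F(5) W0] by metis
  have lip': "dist (f s) (f t) \<le> 1 * dist s t" for s t
    using lip[of s t] lip[of t s] by (cases "s \<le> t") (auto simp: dist_real_def dist_commute)
  have cont: "continuous_on {0..T} f"
    by (rule continuous_onI) (metis lip' dist_commute less_eq_real_def mult_1 order_trans)
  define \<gamma> where "\<gamma> = f ` {0..T}"
  have "continuum \<gamma>"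
    unfolding \<gamma>_def continuum_def using cont
    by (auto intro: compact_continuous_image connected_continuous_image)
  moreover have "f 0 \<in> \<gamma>" "f T \<in> \<gamma>" using T by (auto simp: \<gamma>_def)
  moreover have "f 0 \<in> closure A" "f T \<in> closure A'"
    using F(1,2) closure_subset by (auto intro!: lim)
  moreover have "\<gamma> \<subseteq> cball (f 0) T"
    unfolding \<gamma>_def using lip[of 0] by fastforce
  moreover have "hausdorff1_outer \<gamma> \<le> ennreal T"
    unfolding \<gamma>_def using hausdorff1_outer_lipschitz_curve[of 0 T 1 f] T lip' by simp
  moreover have "hausdorff1_outer (\<gamma> \<inter> U) \<le> ennreal (T / W)"
  proof -
    define V where "V = {t\<in>{0..T}. f t \<in> U}"
    have "\<gamma> \<inter> U = f ` V" by (auto simp: \<gamma>_def V_def)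
    moreover have "hausdorff1_outer (f ` V) \<le> ennreal (1/W * T)"
    proof (rule hausdorff1_locally_lipschitz_part[OF T _ cont])
      fix t assume "t \<in> V"
      then obtain \<delta> where "0 < \<delta>"
        and \<delta>: "\<And>s s'. t - \<delta> < s \<Longrightarrow> s \<le> s' \<Longrightarrow> s' < t + \<delta> \<Longrightarrow> W * dist (f s) (f s') \<le> s' - s"
        using lipU[of t] by (auto simp: V_def)
      then show "\<exists>\<delta>>0. \<forall>s s'. t - \<delta> < s \<and> s \<le> s' \<and> s' < t + \<delta> \<longrightarrow> dist (f s) (f s') \<le> 1/W * (s' - s)"
        using W0 by (intro exI[of _ \<delta>]) (auto simp: field_simps)
    qed (use W in \<open>auto simp: V_def\<close>)
    ultimately show ?thesis by simp
  qed
  ultimately show ?thesis by blast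
qed

section \<open>Approximation of Borel sets by closed sets\<close>

text \<open>The sets with this approximation property form a sigma-algebra; it contains the closed sets, since
a closed set is the intersection of its open neighbourhoods \<open>{x. infdist x C < 1 / (n + 1)}\<close>.
The property is stated with both an open and a closed set so that it passes to complements.\<close>

lemma borel_closed_open_approx:
  fixes M :: "'a::metric_space measure"
  assumes M: "finite_measure M" and sets_M: "sets M = sets borel" and A: "A \<in> sets borel"
  shows "\<forall>e>0. \<exists>F V. closed F \<and> open V \<and> F \<subseteq> A \<and> A \<subseteq> V \<and> measure M (V - F) < e"
proof -
  interpret finite_measure M by (rule M)
  have [measurable, simp]: "B \<in> sets M" if "closed B" for B using that sets_M by simp
  have [measurable, simp]: "B \<in> sets M" if "open B" for B using that sets_M by simp
  have "A \<in> sigma_sets UNIV (Collect closed)" using A by (simp add: borel_eq_closed)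
  then show ?thesis
  proof (induction rule: sigma_sets.induct)
    case (Basic C)
    then have C: "closed C" by simp
    show ?case
    proof (cases "C = {}")
      case True
      then show ?thesis by (intro allI impI exI[of _ "{}"]) simp
    next
      case False
      define V where "V n = {x. infdist x C < 1 / real (Suc n)}" for n
      have opV: "open (V n)" for n
        unfolding V_def by (intro open_Collect_less continuous_intros)
      have CV: "C \<subseteq> V n" for n by (auto simp: V_def)
      have "decseq V"
      proof (rule decseq_SucI)
        fix n
        have "1 / real (Suc (Suc n)) \<le> 1 / real (Suc n)" by (simp add: field_simps)
        then show "V (Suc n) \<subseteq> V n" by (auto simp: V_def)
      qed
      have "(\<Inter>n. V n) = C"
      proof
        show "(\<Inter>n. V n) \<subseteq> C"
        proof
          fix x assume x: "x \<in> (\<Inter>n. V n)"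
          have "infdist x C = 0"
          proof (rule ccontr)
            assume "infdist x C \<noteq> 0"
            then have "0 < infdist x C" using infdist_nonneg[of x C] by simp
            then obtain n where "1 / real (Suc n) < infdist x C" by (metis nat_approx_posE)
            moreover have "x \<in> V n" using x by blast
            ultimately show False by (simp add: V_def)
          qed
          then show "x \<in> C" using C False in_closed_iff_infdist_zero by blast
        qed
      qed (use CV in blast)
      moreover have "range V \<subseteq> sets M" using opV by auto
      ultimately have lim: "(\<lambda>n. measure M (V n)) \<longlonglongrightarrow> measure M C"
        using finite_Lim_measure_decseq[of V] \<open>decseq V\<close> by simp
      show ?thesis
      proof (intro allI impI)
        fix e :: real assume "0 < e"
        then obtain n where "measure M (V n) < measure M C + e"
          using order_tendstoD(2)[OF lim, of "measure M C + e"] by (auto simp: eventually_sequentially)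
        then have "measure M (V n - C) < e"
          using finite_measure_Diff[of "V n" C] CV opV C by simp
        then show "\<exists>F V. closed F \<and> open V \<and> F \<subseteq> C \<and> C \<subseteq> V \<and> measure M (V - F) < e"
          using C opV CV by blast
      qed
    qed
  next
    case Empty
    have "closed {} \<and> open {} \<and> {} \<subseteq> ({}::'a set) \<and> ({}::'a set) \<subseteq> {} \<and> measure M ({} - {}) < e"
      if "0 < e" for e :: real using that by simp
    then show ?case by blast
  next
    case (Compl B)
    show ?case
    proof (intro allI impI)
      fix e :: real assume "0 < e"
      with Compl.IH obtain F V where FV: "closed F" "open V" "F \<subseteq> B" "B \<subseteq> V" "measure M (V - F) < e"
        by (elim allE impE exE conjE)
      have "- F - - V = V - F" by blast
      then have "measure M (- F - - V) < e" using FV(5) by simp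
      moreover have "- V \<subseteq> UNIV - B" "UNIV - B \<subseteq> - F" using FV(3,4) by blast+
      ultimately show "\<exists>F V. closed F \<and> open V \<and> F \<subseteq> UNIV - B \<and> UNIV - B \<subseteq> V \<and> measure M (V - F) < e"
        using FV(1,2) by (metis closed_Compl open_Compl)
    qed
  next
    case (Union B)
    show ?case
    proof (intro allI impI)
      fix e :: real assume e: "0 < e"
      define d where "d n = e / 2 * (1/2) ^ Suc n" for n
      have d: "0 < d n" for n using e by (simp add: d_def)
      have d_sums: "d sums (e / 2)"
        unfolding d_def using sums_mult[OF power_half_series, of "e/2"] by simp
      have "\<exists>F V. closed F \<and> open V \<and> F \<subseteq> B n \<and> B n \<subseteq> V \<and> measure M (V - F) < d n" for n
        using Union.IH[of n] d[of n] by blast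
      \<comment> \<open>a union of infinitely many closed sets need not be closed, hence the finite unions \<open>K N\<close> below\<close>
      then obtain F V where "\<forall>n. closed (F n) \<and> open (V n) \<and> F n \<subseteq> B n \<and> B n \<subseteq> V n \<and> measure M (V n - F n) < d n"
        by metis
      then have FV: "\<And>n. closed (F n)" "\<And>n. open (V n)" "\<And>n. F n \<subseteq> B n" "\<And>n. B n \<subseteq> V n"
        "\<And>n. measure M (V n - F n) < d n" by simp_all
      have [measurable, simp]: "F n \<in> sets M" "V n \<in> sets M" for n using FV by auto
      define K where "K N = (\<Union>n\<le>N. F n)" for N
      have clK: "closed (K N)" for N unfolding K_def using FV by (intro closed_UN) auto
      have "decseq (\<lambda>N. (\<Union>n. V n) - K N)"
        unfolding decseq_def K_def by (intro allI impI Diff_mono UN_mono) auto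
      then have lim: "(\<lambda>N. measure M ((\<Union>n. V n) - K N)) \<longlonglongrightarrow> measure M (\<Inter>N. (\<Union>n. V n) - K N)"
        by (intro finite_Lim_measure_decseq) (auto simp: clK)
      have "measure M (\<Inter>N. (\<Union>n. V n) - K N) \<le> measure M (\<Union>n. V n - F n)"
        by (intro finite_measure_mono) (auto simp: K_def)
      also have "\<dots> \<le> (\<Sum>n. measure M (V n - F n))"
        using FV(5) d_sums
        by (intro finite_measure_subadditive_countably)
          (auto intro!: summable_comparison_test'[of d 0] simp: sums_iff less_imp_le)
      also have "\<dots> \<le> suminf d"
        using FV(5) d_sums
        by (intro suminf_le) (auto intro!: summable_comparison_test'[of d 0] simp: sums_iff less_imp_le)
      also have "\<dots> < e" using d_sums e by (simp add: sums_iff)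
      finally obtain N where "measure M ((\<Union>n. V n) - K N) < e"
        using order_tendstoD(2)[OF lim] by (auto simp: eventually_sequentially)
      moreover have "open (\<Union>n. V n)" using FV(2) by (intro open_UN) simp
      moreover have "K N \<subseteq> (\<Union>n. B n)" unfolding K_def by (rule UN_mono[OF subset_UNIV FV(3)])
      moreover have "(\<Union>n. B n) \<subseteq> (\<Union>n. V n)" by (rule UN_mono[OF subset_UNIV FV(4)])
      ultimately show "\<exists>F V. closed F \<and> open V \<and> F \<subseteq> \<Union> (range B) \<and> \<Union> (range B) \<subseteq> V \<and> measure M (V - F) < e"
        by (intro exI[of _ "K N"] exI[of _ "\<Union>n. V n"] conjI clK)
    qed
  qed
qed

lemma inner_regular_closed:
  fixes \<mu> :: "'a::metric_space measure"
  assumes sets: "sets \<mu> = sets borel" and S: "S \<in> sets borel" and fin: "emeasure \<mu> S < \<infinity>"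
    and a: "a < emeasure \<mu> S"
  shows "\<exists>K. closed K \<and> K \<subseteq> S \<and> a < emeasure \<mu> K"
proof -
  define M where "M = density \<mu> (indicator S)"
  have S': "S \<in> sets \<mu>" using S sets by simp
  have em: "emeasure M X = emeasure \<mu> (S \<inter> X)" if "X \<in> sets borel" for X
    unfolding M_def using that S sets by (intro emeasure_restricted) auto
  have sp: "space \<mu> = UNIV" using sets_eq_imp_space_eq[OF sets] by simp
  have M: "finite_measure M" "sets M = sets borel"
    using em[of UNIV] fin sp by (auto intro!: finite_measureI simp: M_def sets)
  interpret finite_measure M by (rule M)
  obtain s where s: "emeasure \<mu> S = ennreal s" "0 \<le> s" using fin by (cases "emeasure \<mu> S") auto
  obtain b where b: "a = ennreal b" "0 \<le> b" "b < s"
    using a s by (cases a) (auto simp: ennreal_less_iff)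
  obtain K V where K: "closed K" "open V" "K \<subseteq> S" "S \<subseteq> V" "measure M (V - K) < s - b"
    using borel_closed_open_approx[OF M S] b by (metis diff_gt_0_iff_gt)
  have KM: "K \<in> sets borel" "V \<in> sets borel" using K by auto
  have "measure M V = s" using em[OF KM(2)] K(4) s by (simp add: measure_def Int_absorb2)
  moreover have "measure M (V - K) = measure M V - measure M K"
    using K M(2) KM by (intro finite_measure_Diff) auto
  ultimately have "b < measure M K" using K by linarith
  moreover have "emeasure \<mu> K = ennreal (measure M K)"
    using em[OF KM(1)] K(3) by (simp add: emeasure_eq_measure[symmetric] Int_absorb1)
  ultimately show ?thesis using K b by (auto intro!: exI[of _ K] ennreal_lessI)
qed

section \<open>Short chains from the Poincare inequality\<close>

lemma ennpowr_le_two: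
  assumes "t \<le> 2" "1 < Q"
  shows "ennpowr t (1 / Q) \<le> 2"
proof -
  obtain r where r: "t = ennreal r" "0 \<le> r" using assms(1) by (cases t) (auto simp: top_unique)
  then have "r \<le> 2" using assms(1) ennreal_le_iff[of 2 r] by simp
  then have "r powr (1/Q) \<le> 2 powr (1/Q)" using r assms by (intro powr_mono2) auto
  also have "\<dots> \<le> 2 powr 1" using assms by (intro powr_mono) auto
  finally have "ennreal (r powr (1/Q)) \<le> ennreal 2" by (intro ennreal_leI) simp
  then show ?thesis using r by (simp add: ennpowr_def)
qed

text \<open>If all chains from \<open>A\<close> to \<open>A'\<close> were expensive, the truncated cost \<open>u\<close> would be \<open>0\<close> on \<open>A\<close> and \<open>T\<close> on
\<open>A'\<close>.  As both sets fill a fixed proportion \<open>\<kappa>\<close> of the ball \<open>B\<close>, the mean oscillation of \<open>u\<close> would be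
at least \<open>\<kappa> * T\<close>, whatever its average is.  On the other side, \<open>U\<close> is so small that the mean of the
\<open>Q\<close>-th power of the upper gradient, which is \<open>W powr Q\<close> on \<open>U\<close> and \<open>1\<close> elsewhere, is at most \<open>2\<close>, so
the Poincare inequality bounds the oscillation by \<open>2 * D\<close>.  Note that \<open>T\<close> does not depend on \<open>W\<close>: a
large weight can be paid for by a small \<open>U\<close>.\<close>

lemma poincare_short_chain:
  fixes \<mu> :: "'a::metric_space measure" and A A' U B B' :: "'a set"
  assumes sets: "sets \<mu> = sets borel" and Q: "1 < Q"
    and poincare: "\<And>u g. locally_integrable \<mu> u \<Longrightarrow> upper_gradient g u \<Longrightarrow>
      (\<integral>\<^sup>+y\<in>B. ennreal \<bar>u y - average \<mu> B u\<bar> \<partial>\<mu>) / emeasure \<mu> B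
      \<le> ennreal D * ennpowr ((\<integral>\<^sup>+y\<in>B'. ennpowr (g y) Q \<partial>\<mu>) / emeasure \<mu> B') (1 / Q)"
    and locfin: "\<And>z. \<exists>\<rho>>0. emeasure \<mu> (ball z \<rho>) < \<infinity>"
    and borel: "A \<in> sets borel" "A' \<in> sets borel" "U \<in> sets borel" "B \<in> sets borel" "B' \<in> sets borel"
    and sub: "A \<subseteq> B" "A' \<subseteq> B"
    and B: "0 < emeasure \<mu> B" "emeasure \<mu> B < \<infinity>"
    and B': "0 < emeasure \<mu> B'" "emeasure \<mu> B' < \<infinity>"
    and \<kappa>: "0 < \<kappa>" "ennreal \<kappa> * emeasure \<mu> B \<le> emeasure \<mu> A" "ennreal \<kappa> * emeasure \<mu> B \<le> emeasure \<mu> A'"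
    and W: "1 \<le> W" "ennreal (W powr Q) * emeasure \<mu> U \<le> emeasure \<mu> B'"
    and D: "0 \<le> D" "2 * D < \<kappa> * T" and \<epsilon>: "0 < \<epsilon>"
  shows "\<exists>y\<in>A'. \<exists>c<T. chain_cost A U W \<epsilon> y c"
proof (rule ccontr)
  assume no: "\<not> ?thesis"
  have "0 < \<kappa> * T" using D by linarith
  then have T: "0 < T" using \<kappa>(1) by (simp add: zero_less_mult_iff)
  have T0: "0 \<le> T" using T by simp
  define u where "u = truncated_cost A U W \<epsilon> T"
  have uA: "u y = 0" if "y \<in> A" for y
    unfolding u_def using truncated_cost_start[OF W(1) T0 that] .
  have uA': "u y = T" if "y \<in> A'" for y
  proof (rule ccontr)
    assume "u y \<noteq> T"
    then have "truncated_cost A U W \<epsilon> T y < T"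
      using truncated_cost_le[OF W(1) T0, of A U \<epsilon> y] by (simp add: u_def)
    then show False using truncated_cost_chain[OF W(1) T0] no that by metis
  qed
  have disj: "A \<inter> A' = {}" using uA uA' T by fastforce
  have [measurable_cong]: "sets \<mu> = sets borel" by (rule sets)
  have [measurable]: "A \<in> sets \<mu>" "A' \<in> sets \<mu>" "U \<in> sets \<mu>" "B \<in> sets \<mu>" "B' \<in> sets \<mu>"
    using borel sets by auto
  have u_borel: "u \<in> borel_measurable borel"
    unfolding u_def using truncated_cost_continuous[OF W(1) T0 \<epsilon>]
    by (rule borel_measurable_continuous_onI)
  then have [measurable]: "u \<in> borel_measurable \<mu>" using sets by (simp cong: measurable_cong_sets)
  have "locally_integrable \<mu> u"
    unfolding locally_integrable_def
  proof (intro conjI allI)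
    fix x
    obtain \<rho> where \<rho>: "0 < \<rho>" "emeasure \<mu> (ball x \<rho>) < \<infinity>" using locfin by blast
    have bm: "ball x \<rho> \<in> sets \<mu>" using sets by simp
    have "\<bar>u y\<bar> \<le> T" for y
      using truncated_cost_nonneg[OF W(1) T0, of A U \<epsilon> y] truncated_cost_le[OF W(1) T0, of A U \<epsilon> y]
      by (simp add: u_def)
    then have "integrable \<mu> (\<lambda>y. indicator (ball x \<rho>) y *\<^sub>R u y)"
      using \<rho> bm T0
      by (intro integrableI_bounded_set_indicator[where B=T]) auto
    then show "\<exists>r>0. set_integrable \<mu> (ball x r) u"
      using \<rho> unfolding set_integrable_def by blast
  qed measurable
  moreover have "upper_gradient (\<lambda>z. if z \<in> U then ennreal W else 1) u"
    unfolding u_def by (rule truncated_cost_upper_gradient[OF W(1) T0 \<epsilon> borel(3)])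
  ultimately have ineq: "(\<integral>\<^sup>+y\<in>B. ennreal \<bar>u y - average \<mu> B u\<bar> \<partial>\<mu>) / emeasure \<mu> B
      \<le> ennreal D * ennpowr ((\<integral>\<^sup>+y\<in>B'. ennpowr (if y \<in> U then ennreal W else 1) Q \<partial>\<mu>) / emeasure \<mu> B') (1 / Q)"
    by (rule poincare)
  define v where "v = average \<mu> B u"
  have "ennreal (\<kappa> * T) * emeasure \<mu> B \<le> ennreal (\<bar>v\<bar> + \<bar>T - v\<bar>) * (ennreal \<kappa> * emeasure \<mu> B)"
  proof -
    have "ennreal (\<kappa> * T) \<le> ennreal ((\<bar>v\<bar> + \<bar>T - v\<bar>) * \<kappa>)"
      using \<kappa>(1) by (intro ennreal_leI) (auto simp: mult.commute intro!: mult_left_mono)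
    then show ?thesis using \<kappa>(1) by (simp add: ennreal_mult mult.assoc[symmetric] mult_right_mono)
  qed
  also have "\<dots> = ennreal \<bar>v\<bar> * (ennreal \<kappa> * emeasure \<mu> B) + ennreal \<bar>T - v\<bar> * (ennreal \<kappa> * emeasure \<mu> B)"
    by (simp add: distrib_right)
  also have "\<dots> \<le> ennreal \<bar>v\<bar> * emeasure \<mu> A + ennreal \<bar>T - v\<bar> * emeasure \<mu> A'"
    by (intro add_mono mult_left_mono \<kappa>) auto
  also have "\<dots> = (\<integral>\<^sup>+y. ennreal \<bar>v\<bar> * indicator A y + ennreal \<bar>T - v\<bar> * indicator A' y \<partial>\<mu>)"
    by (subst nn_integral_add) (auto simp: nn_integral_cmult_indicator)
  also have "\<dots> \<le> (\<integral>\<^sup>+y\<in>B. ennreal \<bar>u y - v\<bar> \<partial>\<mu>)"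
    using disj sub uA uA' by (intro nn_integral_mono) (auto simp: indicator_def)
  finally have low: "ennreal (\<kappa> * T) \<le> (\<integral>\<^sup>+y\<in>B. ennreal \<bar>u y - v\<bar> \<partial>\<mu>) / emeasure \<mu> B"
    using B by (metis divide_right_mono_ennreal ennreal_mult_divide_eq infinity_ennreal_def less_irrefl)
  have "(\<integral>\<^sup>+y\<in>B'. ennpowr (if y \<in> U then ennreal W else 1) Q \<partial>\<mu>)
      \<le> (\<integral>\<^sup>+y. indicator B' y + ennreal (W powr Q) * indicator U y \<partial>\<mu>)"
    using W by (intro nn_integral_mono) (auto simp: ennpowr_def indicator_def)
  also have "\<dots> = emeasure \<mu> B' + ennreal (W powr Q) * emeasure \<mu> U"
    by (subst nn_integral_add) (auto simp: nn_integral_cmult_indicator)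
  also have "\<dots> \<le> 2 * emeasure \<mu> B'" using W(2) by (simp add: mult_2 add_left_mono)
  finally have "(\<integral>\<^sup>+y\<in>B'. ennpowr (if y \<in> U then ennreal W else 1) Q \<partial>\<mu>) / emeasure \<mu> B' \<le> 2"
    using B' by (metis divide_right_mono_ennreal ennreal_mult_divide_eq infinity_ennreal_def less_irrefl)
  then have "ennreal D * ennpowr ((\<integral>\<^sup>+y\<in>B'. ennpowr (if y \<in> U then ennreal W else 1) Q \<partial>\<mu>) / emeasure \<mu> B') (1 / Q)
      \<le> ennreal D * 2"
    by (intro mult_left_mono ennpowr_le_two Q) auto
  with low ineq have "ennreal (\<kappa> * T) \<le> ennreal D * 2" unfolding v_def by (meson order_trans)
  also have "\<dots> = ennreal (2 * D)" using D by (simp add: ennreal_mult mult.commute)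
  finally show False using D by (simp add: ennreal_le_iff)
qed

lemma exists_point_at_distance:
  fixes x :: "'a::metric_space"
  assumes "connected (UNIV :: 'a set)" "0 \<le> d" "ennreal (2 * d) < ediam (UNIV :: 'a set)"
  shows "\<exists>y. dist x y = d"
proof -
  have "\<exists>z. d \<le> dist x z"
  proof (rule ccontr)
    assume "\<not> ?thesis"
    then have near: "dist x z < d" for z by (simp add: not_le)
    have "dist a b \<le> 2 * d" for a b :: 'a
      using dist_triangle3[of a b x] near[of a] near[of b] by linarith
    then have "ediam (UNIV :: 'a set) \<le> ennreal (2 * d)"
      unfolding ediam_def by (intro SUP_least ennreal_leI)
    then show False using assms(3) by simp
  qed
  then obtain z where z: "d \<le> dist x z" by blast
  have "connected (range (dist x))"
    using assms(1) by (intro connected_continuous_image continuous_intros)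
  then have "{0..dist x z} \<subseteq> range (dist x)"
    by (rule connected_contains_Icc) (auto intro: image_eqI[of _ _ x])
  then show ?thesis using z assms(2) by fastforce
qed

section \<open>Spaces of bounded geometry\<close>

theorem proposition1p6:
  fixes Q :: real and \<mu> :: "'a::metric_space measure"
  assumes "1 < Q" and "bounded_geometry Q \<mu>"
  shows "A_infinity_on_curves \<mu>"
proof -
  have proper: "\<And>(z::'a) \<rho>. compact (cball z \<rho>)"
    and conn: "connected (UNIV :: 'a set)"
    and sets: "sets \<mu> = sets borel"
    using assms(2) by (auto simp: bounded_geometry_def intro: path_connected_imp_connected)
  have "ahlfors_regular Q \<mu>" "poincare_inequality Q \<mu>"
    using assms(2) by (simp_all add: bounded_geometry_def)
  note this[unfolded ahlfors_regular_def poincare_inequality_def]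
  then obtain c C P \<Lambda> where cC: "0 < c" "0 < C" and P: "1 \<le> P" and \<Lambda>: "1 \<le> \<Lambda>"
    and reg: "\<forall>z \<rho>. 0 < \<rho> \<and> ennreal \<rho> \<le> ediam (UNIV :: 'a set) \<longrightarrow>
      ennreal (c * \<rho> powr Q) \<le> emeasure \<mu> (ball z \<rho>) \<and> emeasure \<mu> (ball z \<rho>) \<le> ennreal (C * \<rho> powr Q)"
    and poincare: "\<forall>z \<rho> u g. 0 < \<rho> \<and> locally_integrable \<mu> u \<and> upper_gradient g u \<longrightarrow>
       (\<integral>\<^sup>+y\<in>ball z \<rho>. ennreal \<bar>u y - average \<mu> (ball z \<rho>) u\<bar> \<partial>\<mu>) / emeasure \<mu> (ball z \<rho>)
          \<le> ennreal (P * \<rho>) *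
            ennpowr ((\<integral>\<^sup>+y\<in>ball z (\<Lambda> * \<rho>). ennpowr (g y) Q \<partial>\<mu>) / emeasure \<mu> (ball z (\<Lambda> * \<rho>))) (1 / Q)"
    by (elim exE conjE)
  \<comment> \<open>proportion of a ball that is filled by a ball of an eighth of its radius\<close>
  define \<kappa> where "\<kappa> = c / C * (1/8) powr Q"
  have \<kappa>: "0 < \<kappa>" using cC by (simp add: \<kappa>_def)
  \<comment> \<open>cost of the chains in units of the inner radius \<open>s\<close>; the summand \<open>1\<close> makes \<open>2 * P < \<kappa> * L\<close> strict\<close>
  define L where "L = 2 * P / \<kappa> + 1"
  have L: "1 \<le> L" "\<kappa> * L = 2 * P + \<kappa>" using \<kappa> P by (auto simp: L_def field_simps)
  \<comment> \<open>the part of a curve of cost \<open>L * s\<close> in the bad set then has measure at most \<open>s / 8\<close>\<close>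
  define W where "W = 8 * L"
  have W: "1 \<le> W" using L by (simp add: W_def)
  \<comment> \<open>ratio \<open>r / s\<close>: room for the ball of radius \<open>\<Lambda> * s\<close> and for a curve of length \<open>L * s\<close>\<close>
  define K where "K = L + \<Lambda> + 1"
  have K: "3 \<le> K" "\<Lambda> \<le> K" using L \<Lambda> by (auto simp: K_def)
  \<comment> \<open>proportion of \<open>ball x r\<close> that the bad set may occupy so that \<open>W powr Q\<close> times its measure is at most that of \<open>ball x (\<Lambda> * s)\<close>\<close>
  define q where "q = c * \<Lambda> powr Q / (W powr Q * C * K powr Q)"
  have q: "0 < q" using cC W \<Lambda> K by (simp add: q_def)
  define \<tau> where "\<tau> = 1 - min 1 q"
  have \<tau>: "0 \<le> \<tau>" "\<tau> < 1" "1 - \<tau> \<le> q" using q by (auto simp: \<tau>_def)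
  have "\<exists>\<gamma>. continuum \<gamma> \<and> \<gamma> \<subseteq> ball x r \<and> emeasure hausdorff1 \<gamma> \<le> ennreal r \<and>
      ennreal (1 / (8 * K) * r) \<le> hausdorff1_content (\<gamma> \<inter> S)"
    if r: "0 < r" "ennreal r \<le> ediam (UNIV :: 'a set)" and S: "S \<in> sets borel" "S \<subseteq> ball x r"
      "ennreal \<tau> * emeasure \<mu> (ball x r) < emeasure \<mu> S" for x :: 'a and r S
  proof -
    have reg': "ennreal (c * \<rho> powr Q) \<le> emeasure \<mu> (ball z \<rho>)"
      "emeasure \<mu> (ball z \<rho>) \<le> ennreal (C * \<rho> powr Q)" if "0 < \<rho>" "\<rho> \<le> r" for z \<rho>
      using reg[rule_format, of \<rho> z] that order_trans[OF ennreal_leI[OF that(2)] r(2)] by auto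
    have ball_pos: "0 < emeasure \<mu> (ball z \<rho>)" and ball_fin: "emeasure \<mu> (ball z \<rho>) < \<infinity>"
      if "0 < \<rho>" "\<rho> \<le> r" for z \<rho>
    proof -
      have "0 < ennreal (c * \<rho> powr Q)" using cC that by simp
      then show "0 < emeasure \<mu> (ball z \<rho>)" using reg'(1)[OF that] by (rule less_le_trans)
      show "emeasure \<mu> (ball z \<rho>) < \<infinity>" by (rule le_less_trans[OF reg'(2)[OF that]]) simp
    qed
    have ball_borel: "ball z \<rho> \<in> sets \<mu>" for z \<rho> using sets by simp
    define s where "s = r / K"
    have s: "0 < s" "r = K * s" "s < r" using r K by (auto simp: s_def field_simps)
    have \<Lambda>s: "0 < \<Lambda> * s" "\<Lambda> * s \<le> r" using \<Lambda> s K by (auto intro: mult_right_mono)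
    have Ls: "s + L * s < r" "0 \<le> L * s" using s L \<Lambda> by (auto simp: K_def algebra_simps)
    have "ennreal (2 * (s/2)) < ediam (UNIV :: 'a set)"
      using s r by (intro less_le_trans[OF ennreal_lessI r(2)]) auto
    then obtain y where y: "dist x y = s/2"
      using exists_point_at_distance[OF conn, of "s/2" x] s by auto
    define A where "A = ball x (s/8)"
    define A' where "A' = ball y (s/8)"
    have "emeasure \<mu> S < \<infinity>"
      using emeasure_mono[OF S(2) ball_borel] ball_fin[of r x] r by (auto intro: le_less_trans)
    then obtain F where F: "closed F" "F \<subseteq> S" "ennreal \<tau> * emeasure \<mu> (ball x r) < emeasure \<mu> F"
      using inner_regular_closed[OF sets S(1) _ S(3)] by blast
    \<comment> \<open>the bad set; the closed \<open>F\<close> in place of \<open>S\<close> makes it open\<close>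
    define U where "U = ball x r - F"
    have U: "open U" using F by (auto simp: U_def open_Diff)
    have smallU: "ennreal (W powr Q) * emeasure \<mu> U \<le> emeasure \<mu> (ball x (\<Lambda> * s))"
    proof -
      define m where "m = measure \<mu> (ball x r)"
      have m: "emeasure \<mu> (ball x r) = ennreal m" "0 \<le> m"
        using ball_fin[of r x] r by (auto simp: m_def emeasure_eq_ennreal_measure less_top)
      have mC: "m \<le> C * r powr Q"
        using reg'(2)[of r x] r m cC by (simp add: ennreal_le_iff)
      have FB: "F \<subseteq> ball x r" using F S by auto
      have Fm: "F \<in> sets \<mu>" using F sets by simp
      obtain k where k: "emeasure \<mu> F = ennreal k" "0 \<le> k"
        using emeasure_mono[OF FB ball_borel] m by (cases "emeasure \<mu> F") (auto simp: top_unique)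
      have "\<tau> * m < k"
        using F(3) k m \<tau> by (simp add: ennreal_mult[symmetric] ennreal_less_iff)
      then have "m - k \<le> (1 - \<tau>) * m" by (simp add: algebra_simps)
      also have "\<dots> \<le> q * (C * r powr Q)" using \<tau> m mC q by (intro mult_mono) auto
      also have "\<dots> = c * (\<Lambda> * s) powr Q / W powr Q"
        using s K \<Lambda> cC by (simp add: q_def powr_mult field_simps)
      finally have mk: "W powr Q * (m - k) \<le> c * (\<Lambda> * s) powr Q"
        using W by (simp add: field_simps)
      have "emeasure \<mu> U = ennreal m - ennreal k"
        unfolding U_def using FB Fm k m ball_borel by (subst emeasure_Diff) auto
      also have "\<dots> = ennreal (m - k)" using k by (simp add: ennreal_minus)
      finally have "ennreal (W powr Q) * emeasure \<mu> U = ennreal (W powr Q * (m - k))"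
        by (simp add: ennreal_mult')
      also have "\<dots> \<le> ennreal (c * (\<Lambda> * s) powr Q)" using mk by (rule ennreal_leI)
      also have "\<dots> \<le> emeasure \<mu> (ball x (\<Lambda> * s))" by (rule reg'(1)[OF \<Lambda>s])
      finally show ?thesis .
    qed
    have big: "ennreal \<kappa> * emeasure \<mu> (ball x s) \<le> emeasure \<mu> (ball z (s/8))" for z
    proof -
      have "ennreal \<kappa> * emeasure \<mu> (ball x s) \<le> ennreal \<kappa> * ennreal (C * s powr Q)"
        using reg'(2)[of s x] s by (intro mult_left_mono) auto
      also have "\<dots> = ennreal (\<kappa> * (C * s powr Q))" using \<kappa> by (simp add: ennreal_mult')
      also have "\<kappa> * (C * s powr Q) = c * ((1/8) powr Q * s powr Q)" using cC by (simp add: \<kappa>_def)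
      also have "(1/8) powr Q * s powr Q = (s/8) powr Q" using s by (simp add: powr_mult[symmetric])
      also have "ennreal (c * (s/8) powr Q) \<le> emeasure \<mu> (ball z (s/8))"
        using s by (intro reg'(1)) auto
      finally show ?thesis .
    qed
    have "\<exists>y\<in>A'. \<exists>c<L * s. chain_cost A U W \<epsilon> y c" if "0 < \<epsilon>" for \<epsilon>
    proof (rule poincare_short_chain[OF sets assms(1) poincare[rule_format, of s _ _ x]])
      show "\<exists>\<rho>>0. emeasure \<mu> (ball z \<rho>) < \<infinity>" for z using ball_fin[of r z] r by blast
      show "A \<subseteq> ball x s" using s by (auto simp: A_def)
      show "A' \<subseteq> ball x s"
      proof
        fix z assume "z \<in> A'"
        then show "z \<in> ball x s" using dist_triangle[of x z y] y s by (simp add: A'_def)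
      qed
      show "2 * (P * s) < \<kappa> * (L * s)"
        using L(2) \<kappa> s mult_pos_pos[of \<kappa> s] by (simp add: mult.assoc[symmetric] distrib_right)
      show "ennreal \<kappa> * emeasure \<mu> (ball x s) \<le> emeasure \<mu> A"
        "ennreal \<kappa> * emeasure \<mu> (ball x s) \<le> emeasure \<mu> A'"
        unfolding A_def A'_def by (rule big)+
      show "0 < emeasure \<mu> (ball x s)" "emeasure \<mu> (ball x s) < \<infinity>"
        using s by (auto intro!: ball_pos ball_fin simp del: infinity_ennreal_def)
      show "0 < emeasure \<mu> (ball x (\<Lambda> * s))" "emeasure \<mu> (ball x (\<Lambda> * s)) < \<infinity>"
        by (intro ball_pos ball_fin \<Lambda>s)+
    qed (use U W smallU P s \<kappa> that in \<open>auto simp: A_def A'_def\<close>)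
    then have chains: "\<forall>\<epsilon>>0. \<exists>y\<in>A'. \<exists>c<L * s. chain_cost A U W \<epsilon> y c" by blast
    have "A \<subseteq> cball x (s/8)" by (auto simp: A_def)
    obtain \<gamma> p p' where \<gamma>: "continuum \<gamma>" "p \<in> \<gamma>" "p' \<in> \<gamma>" "p \<in> closure A" "p' \<in> closure A'"
      "\<gamma> \<subseteq> cball p (L * s)" "hausdorff1_outer \<gamma> \<le> ennreal (L * s)"
      "hausdorff1_outer (\<gamma> \<inter> U) \<le> ennreal (L * s / W)"
      using short_chains_limit_curve[OF proper U W Ls(2) \<open>A \<subseteq> cball x (s/8)\<close> chains]
      by (elim exE conjE)
    have p: "dist x p \<le> s/8" "dist y p' \<le> s/8"
      using \<gamma>(4,5) closure_mono[OF ball_subset_cball, of x "s/8"] closure_mono[OF ball_subset_cball, of y "s/8"]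
      by (auto simp: A_def A'_def)
    have \<gamma>r: "\<gamma> \<subseteq> ball x r"
    proof
      fix z assume "z \<in> \<gamma>"
      then have "dist p z \<le> L * s" using \<gamma>(6) by auto
      then show "z \<in> ball x r" using dist_triangle[of x z p] p Ls(1) s by simp
    qed
    have "\<gamma> \<in> sets borel" using \<gamma>(1) by (auto simp: continuum_def intro: borel_closed compact_imp_closed)
    moreover have "ennreal (L * s) \<le> ennreal r" using Ls(1) s(1) by (intro ennreal_leI) linarith
    ultimately have "emeasure hausdorff1 \<gamma> \<le> ennreal r"
      using \<gamma>(7) by (simp add: emeasure_hausdorff1)
    moreover have "ennreal (s/8) \<le> hausdorff1_content (\<gamma> \<inter> S)"
    proof -
      have "s/4 \<le> dist p p'"
        using dist_triangle[of x y p] dist_triangle[of p y p'] p y by (simp add: dist_commute)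
      then have "ennreal (s/4) \<le> ennreal (dist p p')" by (rule ennreal_leI)
      also have "\<dots> \<le> hausdorff1_content \<gamma>"
        using \<gamma> by (intro dist_le_hausdorff1_content_connected) (auto simp: continuum_def)
      also have "\<dots> \<le> hausdorff1_content ((\<gamma> \<inter> S) \<union> (\<gamma> \<inter> U))"
        using \<gamma>r F(2) by (intro hausdorff1_content_mono) (auto simp: U_def)
      also have "\<dots> \<le> hausdorff1_content (\<gamma> \<inter> S) + hausdorff1_outer (\<gamma> \<inter> U)"
        by (rule order_trans[OF hausdorff1_content_Un add_left_mono[OF hausdorff1_content_le_outer]])
      also have "\<dots> \<le> hausdorff1_content (\<gamma> \<inter> S) + ennreal (s/8)"
        using \<gamma>(8) L by (intro add_left_mono) (simp add: W_def)
      also have "ennreal (s/4) = ennreal (s/8) + ennreal (s/8)"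
        using s by (subst ennreal_plus[symmetric]) auto
      finally show ?thesis by (simp add: add.commute ennreal_add_left_cancel_le)
    qed
    ultimately show ?thesis using \<gamma>(1) \<gamma>r K by (intro exI[of _ \<gamma>]) (simp add: s_def mult.commute)
  qed
  then have "\<forall>x r S. 0 < r \<and> ennreal r \<le> ediam (UNIV :: 'a set) \<and> S \<in> sets borel \<and> S \<subseteq> ball x r \<and>
      ennreal \<tau> * emeasure \<mu> (ball x r) < emeasure \<mu> S \<longrightarrow>
      (\<exists>\<gamma>. continuum \<gamma> \<and> \<gamma> \<subseteq> ball x r \<and> emeasure hausdorff1 \<gamma> \<le> ennreal r \<and>
        ennreal (1 / (8 * K) * r) \<le> hausdorff1_content (\<gamma> \<inter> S))"
    by (intro allI impI) (elim conjE)
  moreover have "0 < 1 / (8 * K)" using K by simp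
  ultimately show ?thesis
    unfolding A_infinity_on_curves_def using \<tau>(1,2)
    by (intro exI[of _ \<tau>] exI[of _ "1 / (8 * K)"] conjI)
qed

end
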